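(* For every integer $n\ge 5$, up to isomorphism, \[\operatorname{obs}(C_n)=C(n-2)\cup LF(n-1)\cup O(n-1),\] where for a positive integer $k$: $C(k)=\{C_m: m=3\text{ or }5\le m\le k+1\}$; $O(k)=\varnothing$ if $k\le 4$, $O(5)=\{B\}$, $O(6)=\{A,B\}$, and $O(k)=\{A,B,E\}$ if $k\ge 7$; $LF(k)=LF_1(k)\cup LF_2(k)\cup LF_3(k)$ with (all $m_2,m_4,m_6$ ranging over non-negative integers) $LF_1(k)=\{m_2K_2: 3m_2=k+2\}$, $LF_2(k)=\{K_1+m_2K_2+m_4P_4: 3m_2+5m_4=k+1\}$, $LF_3(k)=\{K_1+m_2K_2+m_4P_4+m_6P_6: 3m_2+5m_4+7m_6=k\}$.
   Context: All graphs are finite, simple and loopless. $P_n$ and $C_n$ denote the path and cycle on $n$ vertices; $K_1$, $K_2$ are the complete graphs on one and two vertices; $+$ denotes disjoint union and $mG$ the disjoint union of $m$ copies of $G$. A full-homomorphism $\varphi\colon G\to H$ is a map $V(G)\to V(H)$ such that for all $x,y\in V(G)$, $xy\in E(G)$ if and only if $\varphi(x)\varphi(y)\in E(H)$. A full $H$-colouring of $G$ is a full-homomorphism $G\to H$. A minimal $H$-obstruction is a graph $G$ that admits no full $H$-colouring while every proper induced subgraph of $G$ admits one; $\operatorname{obs}(H)$ denotes the set of minimal $H$-obstructions (up to isomorphism). The graphs $A$, $B$, $E$ have vertex set $\{v_0,\dots,v_5\}$ and edge sets: $E(A)=\{v_0v_1,v_1v_2,v_2v_3,v_3v_4,v_4v_5,v_1v_4\}$;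 $E(B)=E(A)\cup\{v_0v_5\}$; $E(E)=\{v_0v_1,v_1v_2,v_0v_5,v_1v_4,v_2v_3\}$. *)

theory Defs
  imports Main
begin

type_synonym 'a graph = "'a set \<times> ('a \<times> 'a) set"

definition verts :: "'a graph \<Rightarrow> 'a set" where "verts G = fst G"
definition edges :: "'a graph \<Rightarrow> ('a \<times> 'a) set" where "edges G = snd G"

definition wf_graph :: "'a graph \<Rightarrow> bool" where
  "wf_graph G \<longleftrightarrow> finite (verts G) \<and> edges G \<subseteq> verts G \<times> verts G
     \<and> sym (edges G) \<and> irrefl (edges G)"

definition full_hom :: "'a graph \<Rightarrow> 'b graph \<Rightarrow> ('a \<Rightarrow> 'b) \<Rightarrow> bool" where
  "full_hom G H f \<longleftrightarrow> f ` verts G \<subseteq> verts H \<and>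
     (\<forall>x\<in>verts G. \<forall>y\<in>verts G. (x, y) \<in> edges G \<longleftrightarrow> (f x, f y) \<in> edges H)"

definition full_colourable :: "'a graph \<Rightarrow> 'b graph \<Rightarrow> bool" where
  "full_colourable G H \<longleftrightarrow> (\<exists>f. full_hom G H f)"

definition induced :: "'a graph \<Rightarrow> 'a set \<Rightarrow> 'a graph" where
  "induced G S = (S, edges G \<inter> (S \<times> S))"

definition min_obstruction :: "'a graph \<Rightarrow> 'b graph \<Rightarrow> bool" where
  "min_obstruction G H \<longleftrightarrow> \<not> full_colourable G H \<and>
     (\<forall>S. S \<subset> verts G \<longrightarrow> full_colourable (induced G S) H)"

definition isomorphic :: "'a graph \<Rightarrow> 'b graph \<Rightarrow> bool" where
  "isomorphic G H \<longleftrightarrow> (\<exists>f. bij_betw f (verts G) (verts H) \<and>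
     (\<forall>x\<in>verts G. \<forall>y\<in>verts G. (x, y) \<in> edges G \<longleftrightarrow> (f x, f y) \<in> edges H))"

definition cycle :: "nat \<Rightarrow> nat graph" where
  "cycle n = ({0..<n}, {(i, j). i < n \<and> j < n \<and> (j = Suc i mod n \<or> i = Suc j mod n)})"

text \<open>Disjoint union of paths P_{l_0} + P_{l_1} + ...; vertex (i,j) is the j-th vertex
  of the i-th path.  K_1 = P_1, K_2 = P_2.\<close>
definition path_forest :: "nat list \<Rightarrow> (nat \<times> nat) graph" where
  "path_forest ls = ({(i, j). i < length ls \<and> j < ls ! i},
     {((i, j), (i', j')). i = i' \<and> i < length ls \<and> j < ls ! i \<and> j' < ls ! i \<and>
        (j' = Suc j \<or> j = Suc j')})"

definition graph_of :: "nat \<Rightarrow> (nat \<times> nat) list \<Rightarrow> nat graph" where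
  "graph_of n es = ({0..<n}, set es \<union> (set es)\<inverse>)"

definition graphA :: "nat graph" where
  "graphA = graph_of 6 [(0,1),(1,2),(2,3),(3,4),(4,5),(1,4)]"
definition graphB :: "nat graph" where
  "graphB = graph_of 6 [(0,1),(1,2),(2,3),(3,4),(4,5),(1,4),(0,5)]"
definition graphE :: "nat graph" where
  "graphE = graph_of 6 [(0,1),(1,2),(0,5),(1,4),(2,3)]"

definition in_C :: "nat \<Rightarrow> 'a graph \<Rightarrow> bool" where
  "in_C k G \<longleftrightarrow> (\<exists>m. (m = 3 \<or> (5 \<le> m \<and> m \<le> k + 1)) \<and> isomorphic G (cycle m))"

definition in_LF :: "nat \<Rightarrow> 'a graph \<Rightarrow> bool" where
  "in_LF k G \<longleftrightarrow>
     (\<exists>m2. 3 * m2 = k + 2 \<and> isomorphic G (path_forest (replicate m2 2)))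
   \<or> (\<exists>m2 m4. 3 * m2 + 5 * m4 = k + 1 \<and>
        isomorphic G (path_forest (1 # replicate m2 2 @ replicate m4 4)))
   \<or> (\<exists>m2 m4 m6. 3 * m2 + 5 * m4 + 7 * m6 = k \<and>
        isomorphic G (path_forest (1 # replicate m2 2 @ replicate m4 4 @ replicate m6 6)))"

definition in_O :: "nat \<Rightarrow> 'a graph \<Rightarrow> bool" where
  "in_O k G \<longleftrightarrow>
     (k = 5 \<and> isomorphic G graphB)
   \<or> (k = 6 \<and> (isomorphic G graphA \<or> isomorphic G graphB))
   \<or> (k \<ge> 7 \<and> (isomorphic G graphA \<or> isomorphic G graphB \<or> isomorphic G graphE))"

end

theory Submission
  imports Defs "HOL-Combinatorics.List_Permutation"
begin

text \<open>
  A minimal obstruction \<open>G\<close> has no two vertices with the same neighbourhood (a colouring of \<open>G\<close>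
  minus one twin extends), and a full homomorphism from a twin-free graph is an induced embedding.
  An induced subgraph of \<open>C\<^sub>n\<close> with vertex set \<open>V\<close> and edge set \<open>E\<close> satisfies
  \<open>2|V| - |E| \<le> n\<close>, and for linear forests this inequality also suffices for an embedding.
  Hence, if \<open>G\<close> minus a vertex \<open>v\<close> is still twin-free, minimality gives
  \<open>2|V| - |E| - 2 + deg v \<le> n\<close>; for a linear forest \<open>G\<close>, where \<open>2|V| - |E| > n\<close>, suitable choices
  of \<open>v\<close> leave only the components \<open>K\<^sub>1\<close>, \<open>K\<^sub>2\<close>, \<open>P\<^sub>4\<close>, \<open>P\<^sub>6\<close> and the stated numerical conditions.
  If \<open>G\<close> is not a linear forest, then it contains a triangle, or a 4-cycle, which twin-freeness
  enlarges to \<open>A\<close> or \<open>B\<close>, or a 5-cycle, or a vertex of degree three, which twin-freeness enlarges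
  to \<open>E\<close>, or it has maximum degree two and a cycle as a component; in each case minimality forces
  \<open>G\<close> to be that subgraph.
\<close>

section \<open>Full homomorphisms into cycles\<close>

text \<open>For a linear forest, \<open>2|V| - |E|\<close> is a length: placed on the cycle, a path
  with l vertices takes l + 1 positions, its own and one gap, and
  \<open>sum_list (map Suc ls)\<close>, called the width below, adds these up. As
  \<open>edges\<close> holds ordered pairs, the inequality appears doubled. Deleting v changes the
  width by deg v - 2. In P_4 and P_6, deleting a vertex of degree two leaves a P_3 or a new isolated
  vertex, so it creates twins once a K_1 is present; in P_5 and in paths longer than P_6 it can be
  done without twins. Deleting an isolated vertex bounds the width by n + 2, deleting an end vertex
  by n + 1; with contributions 2, 3, 5, 7 from K_1, K_2, P_4, P_6 these two widths are the three
  equations for \<open>in_LF\<close>. The thresholds for A, B, E are widths too: deleting vertex 1,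
  of degree three, leaves K_1 + P_4, P_5 and K_1 + 2K_2, of widths 7, 6 and 8. One obstacle is a
  copy of C_n inside G: it is colourable, so minimality does not make it all of G. There a cycle
  vertex is exchanged for a vertex outside, which yields a twin-free graph on n vertices; an
  embedding of it would be onto, although the new vertex has degree at most one.\<close>

definition twin_free :: "'a graph \<Rightarrow> bool" where
  "twin_free G \<longleftrightarrow> (\<forall>x\<in>verts G. \<forall>y\<in>verts G.
     (\<forall>z\<in>verts G. (x, z) \<in> edges G \<longleftrightarrow> (y, z) \<in> edges G) \<longrightarrow> x = y)"

lemma verts_induced [simp]: "verts (induced G S) = S"
  by (simp add: induced_def verts_def)

lemma edges_induced [simp]:
  "(x, y) \<in> edges (induced G S) \<longleftrightarrow> (x, y) \<in> edges G \<and> x \<in> S \<and> y \<in> S"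
  by (auto simp: induced_def edges_def)

lemma edges_induced_eq: "edges (induced G S) = edges G \<inter> S \<times> S"
  by (simp add: induced_def edges_def)

lemma verts_cycle [simp]: "verts (cycle n) = {0..<n}"
  by (simp add: cycle_def verts_def)

lemma edges_cycle:
  "(i, j) \<in> edges (cycle n) \<longleftrightarrow> i < n \<and> j < n \<and>
     (j = Suc i \<or> i = Suc j \<or> (i = 0 \<and> Suc j = n) \<or> (j = 0 \<and> Suc i = n))"
  by (auto simp: cycle_def edges_def mod_Suc)

lemma wf_graph_sym: "wf_graph G \<Longrightarrow> (x, y) \<in> edges G \<Longrightarrow> (y, x) \<in> edges G"
  by (auto simp: wf_graph_def sym_def)

lemma wf_graph_irrefl: "wf_graph G \<Longrightarrow> (x, x) \<notin> edges G"
  by (auto simp: wf_graph_def irrefl_def)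

lemma wf_graph_verts: "wf_graph G \<Longrightarrow> (x, y) \<in> edges G \<Longrightarrow> x \<in> verts G \<and> y \<in> verts G"
  by (auto simp: wf_graph_def)

lemma wf_graph_induced:
  assumes "wf_graph G" "S \<subseteq> verts G"
  shows "wf_graph (induced G S)"
  using assms unfolding wf_graph_def
  by (auto simp: edges_induced_eq sym_def irrefl_def intro: finite_subset)

lemma finite_edges: "wf_graph G \<Longrightarrow> finite (edges G)"
  unfolding wf_graph_def using finite_subset by blast

lemma full_hom_edge:
  "full_hom G H f \<Longrightarrow> x \<in> verts G \<Longrightarrow> y \<in> verts G \<Longrightarrow>
     (x, y) \<in> edges G \<longleftrightarrow> (f x, f y) \<in> edges H"
  by (simp add: full_hom_def)

lemma full_hom_verts: "full_hom G H f \<Longrightarrow> x \<in> verts G \<Longrightarrow> f x \<in> verts H"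
  by (auto simp: full_hom_def)

lemma full_hom_comp:
  assumes "full_hom G H f" "full_hom H K g"
  shows "full_hom G K (g \<circ> f)"
proof -
  have "\<And>x. x \<in> verts G \<Longrightarrow> f x \<in> verts H" "\<And>x. x \<in> verts H \<Longrightarrow> g x \<in> verts K"
    using assms full_hom_verts by metis+
  then show ?thesis using assms by (auto simp: full_hom_def)
qed

lemma full_colourable_comp:
  "full_hom G H f \<Longrightarrow> full_colourable H K \<Longrightarrow> full_colourable G K"
  unfolding full_colourable_def using full_hom_comp by blast

lemma full_hom_mono_induced: "S \<subseteq> T \<Longrightarrow> full_hom (induced G S) (induced G T) (\<lambda>x. x)"
  by (auto simp: full_hom_def)

text \<open>Vertices with a common image have the same neighbours, because a full homomorphism also
  reflects edges.\<close>

lemma full_hom_inj_on: "full_hom G H f \<Longrightarrow> twin_free G \<Longrightarrow> inj_on f (verts G)"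
  unfolding inj_on_def twin_free_def by (metis full_hom_edge)

section \<open>Transport along isomorphisms and reduction to single deletions\<close>

lemma isomorphic_full_hom:
  "isomorphic G H \<longleftrightarrow> (\<exists>f. bij_betw f (verts G) (verts H) \<and> full_hom G H f)"
  by (auto simp: isomorphic_def full_hom_def bij_betw_def)

lemma isomorphic_sym:
  assumes "isomorphic G H"
  shows "isomorphic H G"
proof -
  obtain f where f: "bij_betw f (verts G) (verts H)" "full_hom G H f"
    using assms isomorphic_full_hom by blast
  let ?g = "inv_into (verts G) f"
  have g: "bij_betw ?g (verts H) (verts G)" using f(1) by (rule bij_betw_inv_into)
  moreover have "full_hom H G ?g"
    unfolding full_hom_def
  proof (intro conjI ballI)
    show "?g ` verts H \<subseteq> verts G" using g by (simp add: bij_betw_def)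
    fix x y assume "x \<in> verts H" "y \<in> verts H"
    then have "?g x \<in> verts G" "?g y \<in> verts G" "f (?g x) = x" "f (?g y) = y"
      using g f(1) by (auto simp: bij_betw_inv_into_right bij_betwE)
    then show "((x, y) \<in> edges H) = ((?g x, ?g y) \<in> edges G)"
      using full_hom_edge[OF f(2)] by metis
  qed
  ultimately show ?thesis using isomorphic_full_hom by blast
qed

lemma isomorphic_trans:
  "isomorphic G H \<Longrightarrow> isomorphic H K \<Longrightarrow> isomorphic G K"
  unfolding isomorphic_full_hom using full_hom_comp bij_betw_trans by metis

lemma isomorphic_colourable:
  "isomorphic G H \<Longrightarrow> full_colourable H K \<Longrightarrow> full_colourable G K"
  unfolding isomorphic_full_hom using full_colourable_comp by blast

lemma isomorphic_min_obstruction: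
  assumes "isomorphic G H" "min_obstruction H K"
  shows "min_obstruction G K"
proof -
  obtain f where f: "bij_betw f (verts G) (verts H)" "full_hom G H f"
    using assms(1) isomorphic_full_hom by blast
  have "\<not> full_colourable H K" using assms(2) by (simp add: min_obstruction_def)
  then have "\<not> full_colourable G K"
    using isomorphic_colourable[OF isomorphic_sym[OF assms(1)]] by metis
  moreover have "full_colourable (induced G S) K" if S: "S \<subset> verts G" for S
  proof -
    have "f ` S \<subset> verts H"
      using image_strict_mono[of f "verts G" S] S f(1) by (simp add: bij_betw_def)
    moreover have "full_hom (induced G S) (induced H (f ` S)) f"
      using f(2) S by (auto simp: full_hom_def)
    moreover have "\<And>T. T \<subset> verts H \<Longrightarrow> full_colourable (induced H T) K"
      using assms(2) by (simp add: min_obstruction_def)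
    ultimately show ?thesis using full_colourable_comp by metis
  qed
  ultimately show ?thesis by (simp add: min_obstruction_def)
qed

lemma isomorphic_of_list:
  assumes "distinct vs" "set vs = verts G" "verts H = {0..<length vs}"
    and "\<And>i j. i < length vs \<Longrightarrow> j < length vs \<Longrightarrow>
           (vs ! i, vs ! j) \<in> edges G \<longleftrightarrow> (i, j) \<in> edges H"
  shows "isomorphic G H"
proof -
  have "bij_betw ((!) vs) {0..<length vs} (set vs)"
    using assms(1) by (simp add: bij_betw_nth atLeast0LessThan)
  then have "isomorphic H G" using assms unfolding isomorphic_def by auto
  then show ?thesis by (rule isomorphic_sym)
qed

lemma min_obstruction_verts:
  "min_obstruction G H \<Longrightarrow> S \<subseteq> verts G \<Longrightarrow> \<not> full_colourable (induced G S) H \<Longrightarrow> verts G = S"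
  unfolding min_obstruction_def by blast

text \<open>Colourability passes to induced subgraphs, so deletions of single vertices cover all
  proper subsets.\<close>

lemma min_obstructionI:
  assumes "\<not> full_colourable G H"
    and "\<And>v. v \<in> verts G \<Longrightarrow> full_colourable (induced G (verts G - {v})) H"
  shows "min_obstruction G H"
  unfolding min_obstruction_def
proof (intro conjI allI impI)
  fix S assume "S \<subset> verts G"
  then obtain v where "v \<in> verts G" "S \<subseteq> verts G - {v}" by blast
  then show "full_colourable (induced G S) H"
    using assms(2) full_colourable_comp[OF full_hom_mono_induced] by blast
qed (use assms(1) in auto)

lemma min_obstruction_twin_free:
  assumes "wf_graph G" "min_obstruction G H"
    and irr: "\<And>v. (v, v) \<notin> edges H"
  shows "twin_free G"
proof (rule ccontr)
  assume "\<not> twin_free G"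
  then obtain x y where xy: "x \<in> verts G" "y \<in> verts G" "x \<noteq> y"
    and tw: "\<And>z. z \<in> verts G \<Longrightarrow> (x, z) \<in> edges G \<longleftrightarrow> (y, z) \<in> edges G"
    unfolding twin_free_def by blast
  have tw': "(z, x) \<in> edges G \<longleftrightarrow> (z, y) \<in> edges G" if "z \<in> verts G" for z
    using tw[OF that] wf_graph_sym[OF assms(1)] by blast
  have "verts G - {x} \<subset> verts G" using xy by blast
  then obtain f where f: "full_hom (induced G (verts G - {x})) H f"
    using assms(2) unfolding min_obstruction_def full_colourable_def by blast
  \<comment> \<open>Twins are non-adjacent in a loopless graph, and \<open>irr\<close> keeps their
    common colour non-adjacent to itself.\<close>
  have "full_hom G H (f(x := f y))"
    using f xy tw tw' irr wf_graph_irrefl[OF assms(1)]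
    unfolding full_hom_def by auto
  then show False using assms(2) unfolding min_obstruction_def full_colourable_def by blast
qed

section \<open>Which graphs embed into a cycle\<close>

lemma cycle_irrefl: "n \<ge> 2 \<Longrightarrow> (v, v) \<notin> edges (cycle n)"
  by (auto simp: edges_cycle)

lemma wf_graph_cycle: "n \<ge> 2 \<Longrightarrow> wf_graph (cycle n)"
  unfolding wf_graph_def sym_def irrefl_def by (auto simp: edges_cycle)

text \<open>The successors on the cycle of those image points whose successor is no image point
  lie outside the image, and every other image point accounts for one edge.\<close>

lemma cycle_embedding_bound:
  assumes "wf_graph G" "full_hom G (cycle n) f" "inj_on f (verts G)" "n \<ge> 3"
  shows "4 * card (verts G) \<le> card (edges G) + 2 * n"
proof -
  define s where "s i = (if Suc i = n then 0 else Suc i)" for i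
  define S where "S = f ` verts G"
  let ?T = "{i \<in> S. s i \<in> S}"
  have Sn: "S \<subseteq> {0..<n}" using assms(2) by (auto simp: full_hom_def S_def)
  then have finS: "finite S" by (rule finite_subset) simp
  have inj_s: "inj_on s {0..<n}" by (auto simp: inj_on_def s_def split: if_splits)
  have cardS: "card S = card (verts G)" unfolding S_def using assms(3) by (rule card_image)
  have "card (S \<union> s ` (S - ?T)) \<le> card {0..<n}"
    by (rule card_mono) (use Sn in \<open>auto simp: s_def\<close>)
  moreover have "card (S \<union> s ` (S - ?T)) = card S + card (s ` (S - ?T))"
    by (rule card_Un_disjoint) (use finS in auto)
  moreover have "card (s ` (S - ?T)) = card (S - ?T)"
    by (rule card_image) (rule inj_on_subset[OF inj_s], use Sn in auto)
  moreover have "card (S - ?T) = card S - card ?T"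
    by (rule card_Diff_subset) (use finS in auto)
  moreover have "card ?T \<le> card S" by (rule card_mono) (use finS in auto)
  ultimately have 1: "2 * card (verts G) \<le> n + card ?T" using cardS by simp
  let ?L = "(\<lambda>i. (i, s i)) ` ?T" and ?R = "(\<lambda>i. (s i, i)) ` ?T"
  have "(a, b) \<in> (\<lambda>(x, y). (f x, f y)) ` edges G" if ab: "a \<in> S" "b \<in> S" "b = s a \<or> a = s b" for a b
  proof -
    obtain x y where xy: "x \<in> verts G" "y \<in> verts G" "a = f x" "b = f y" using ab unfolding S_def by blast
    have "a < n" "b < n" using ab Sn by auto
    then have "(a, b) \<in> edges (cycle n)" using ab(3) by (auto simp: edges_cycle s_def split: if_splits)
    then have "(x, y) \<in> edges G" using full_hom_edge[OF assms(2) xy(1,2)] xy by simp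
    then show ?thesis using xy by force
  qed
  then have "?L \<union> ?R \<subseteq> (\<lambda>(x, y). (f x, f y)) ` edges G" by auto
  then have "card (?L \<union> ?R) \<le> card ((\<lambda>(x, y). (f x, f y)) ` edges G)"
    by (rule card_mono[rotated]) (simp add: finite_edges assms(1))
  also have "\<dots> \<le> card (edges G)" by (rule card_image_le) (simp add: finite_edges assms(1))
  finally have "card (?L \<union> ?R) \<le> card (edges G)" .
  \<comment> \<open>The two orientations could overlap only if \<open>s (s i) = i\<close> for some
    \<open>i\<close>, which \<open>n \<ge> 3\<close> rules out.\<close>
  moreover have "card (?L \<union> ?R) = card ?L + card ?R"
    by (rule card_Un_disjoint) (use finS assms(4) in \<open>auto simp: s_def split: if_splits\<close>)
  moreover have "card ?L = card ?T" "card ?R = card ?T"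
    by (rule card_image, simp add: inj_on_def)+
  ultimately show ?thesis using 1 by simp
qed

lemma not_colourable_of_card:
  assumes "wf_graph G" "twin_free G" "n \<ge> 3" "card (edges G) + 2 * n < 4 * card (verts G)"
  shows "\<not> full_colourable G (cycle n)"
  using cycle_embedding_bound[OF assms(1) _ _ assms(3)] full_hom_inj_on[OF _ assms(2)] assms(4)
  unfolding full_colourable_def by (meson not_le)

lemma cycle_nbrs_at_most_two:
  "(v, x) \<in> edges (cycle n) \<Longrightarrow> (v, y) \<in> edges (cycle n) \<Longrightarrow> (v, z) \<in> edges (cycle n) \<Longrightarrow>
     x = y \<or> x = z \<or> y = z"
  by (auto simp: edges_cycle)

lemma cycle_two_nbrs:
  assumes "n \<ge> 3" "i < n"
  obtains j k where "j \<noteq> k" "(i, j) \<in> edges (cycle n)" "(i, k) \<in> edges (cycle n)"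
proof
  let ?j = "if Suc i = n then 0 else Suc i" and ?k = "if i = 0 then n - 1 else i - 1"
  show "?j \<noteq> ?k" "(i, ?j) \<in> edges (cycle n)" "(i, ?k) \<in> edges (cycle n)"
    using assms by (auto simp: edges_cycle)
qed

text \<open>An injective map from n vertices into the n-cycle is onto, so both cycle neighbours of
  \<open>f v\<close> are images. This settles the cases in which G contains a copy of
  \<open>cycle n\<close>.\<close>

lemma spanning_embedding_two_nbrs:
  assumes "full_colourable G (cycle n)" "twin_free G" "card (verts G) = n" "n \<ge> 3" "v \<in> verts G"
  obtains x y where "x \<noteq> y" "x \<in> verts G" "y \<in> verts G" "(v, x) \<in> edges G" "(v, y) \<in> edges G"
proof -
  obtain f where f: "full_hom G (cycle n) f" using assms(1) full_colourable_def by blast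
  have "card (f ` verts G) = n" using full_hom_inj_on[OF f assms(2)] assms(3) card_image by blast
  moreover have "f ` verts G \<subseteq> {0..<n}" using f by (auto simp: full_hom_def)
  ultimately have im: "f ` verts G = {0..<n}" by (metis card_atLeastLessThan card_subset_eq diff_zero finite_atLeastLessThan)
  then have "f v < n" using assms(5) by auto
  then obtain j k where jk: "j \<noteq> k" "(f v, j) \<in> edges (cycle n)" "(f v, k) \<in> edges (cycle n)"
    using cycle_two_nbrs assms(4) by metis
  then have "j \<in> f ` verts G" "k \<in> f ` verts G" using im by (auto simp: edges_cycle)
  then obtain x y where "x \<in> verts G" "y \<in> verts G" "j = f x" "k = f y" by blast
  then show ?thesis using that[of x y] jk full_hom_edge[OF f] assms(5) by metis
qed

text \<open>Connectedness of the cycle: climb from \<open>i\<close> to \<open>n - 1\<close>, step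
  over to 0, and climb again.\<close>

lemma cycle_closed_subset:
  assumes "i \<in> S" "S \<subseteq> {0..<n}" and cl: "\<And>i j. i \<in> S \<Longrightarrow> (i, j) \<in> edges (cycle n) \<Longrightarrow> j \<in> S"
  shows "S = {0..<n}"
proof -
  have up: "k < n \<longrightarrow> k \<in> S" if "j \<in> S" "j \<le> k" for j k
    using that(2)
  proof (induction k rule: dec_induct)
    case (step k)
    then show ?case using cl[of k "Suc k"] by (auto simp: edges_cycle)
  qed (use that in auto)
  have "i < n" using assms by auto
  then have "n - 1 \<in> S" using up[of i "n - 1"] assms by auto
  then have "0 \<in> S" using cl[of "n - 1" 0] \<open>i < n\<close> by (auto simp: edges_cycle)
  then show ?thesis using up[of 0] assms(2) by auto
qed

text \<open>A twin of \<open>x\<close> is adjacent to both neighbours of \<open>x\<close>; only in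
  the 4-cycle does a second such vertex exist.\<close>

lemma twin_free_cycle:
  assumes "m \<ge> 3" "m \<noteq> 4"
  shows "twin_free (cycle m)"
  unfolding twin_free_def
proof (intro ballI impI)
  fix x y assume xy: "x \<in> verts (cycle m)" "y \<in> verts (cycle m)"
    and tw: "\<forall>z\<in>verts (cycle m). (x, z) \<in> edges (cycle m) \<longleftrightarrow> (y, z) \<in> edges (cycle m)"
  let ?j = "if Suc x = m then 0 else Suc x" and ?k = "if x = 0 then m - 1 else x - 1"
  have "(x, ?j) \<in> edges (cycle m)" "(x, ?k) \<in> edges (cycle m)"
    using assms xy by (auto simp: edges_cycle)
  then have "(y, ?j) \<in> edges (cycle m)" "(y, ?k) \<in> edges (cycle m)"
    using tw by (metis (no_types, lifting) edges_cycle verts_cycle atLeastLessThan_iff zero_le)+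
  then show "x = y"
    using assms xy by (cases "Suc x = m"; cases "x = 0") (simp_all add: edges_cycle, (presburger | linarith)+)
qed

text \<open>The map is injective, so the two neighbours of a vertex of \<open>cycle m\<close> have
  distinct images, and these are all the neighbours of its image. The image is thus closed under
  adjacency and fills \<open>cycle n\<close>, forcing \<open>m = n\<close>. This covers
  \<open>m < n\<close> and \<open>m > n\<close> alike.\<close>

lemma cycle_not_colourable:
  assumes "m \<ge> 3" "m \<noteq> 4" "m \<noteq> n"
  shows "\<not> full_colourable (cycle m) (cycle n)"
proof
  assume "full_colourable (cycle m) (cycle n)"
  then obtain f where f: "full_hom (cycle m) (cycle n) f" unfolding full_colourable_def by blast
  have inj: "inj_on f {0..<m}"
    using full_hom_inj_on[OF f twin_free_cycle[OF assms(1,2)]] by simp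
  have "f ` {0..<m} = {0..<n}"
  proof (rule cycle_closed_subset)
    show "f 0 \<in> f ` {0..<m}" using assms by auto
    show "f ` {0..<m} \<subseteq> {0..<n}" using f by (auto simp: full_hom_def)
    fix a b assume a: "a \<in> f ` {0..<m}" and ab: "(a, b) \<in> edges (cycle n)"
    obtain i where i: "i < m" "a = f i" using a by auto
    obtain j k where jk: "j \<noteq> k" "(i, j) \<in> edges (cycle m)" "(i, k) \<in> edges (cycle m)"
      using cycle_two_nbrs assms(1) i(1) by metis
    then have lt: "j < m" "k < m" by (auto simp: edges_cycle)
    then have "(a, f j) \<in> edges (cycle n)" "(a, f k) \<in> edges (cycle n)"
      using full_hom_edge[OF f, of i] i jk by auto
    moreover have "f j \<noteq> f k" using inj_on_eq_iff[OF inj] jk(1) lt by simp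
    ultimately have "b = f j \<or> b = f k" using cycle_nbrs_at_most_two[OF ab] by metis
    then show "b \<in> f ` {0..<m}" using lt by auto
  qed
  then have "m = n" using card_image[OF inj] by simp
  then show False using assms(3) by simp
qed

lemma line_colouring:
  assumes "\<And>x. x \<in> verts G \<Longrightarrow> f x + 1 < n"
    and "\<And>x y. x \<in> verts G \<Longrightarrow> y \<in> verts G \<Longrightarrow>
           (x, y) \<in> edges G \<longleftrightarrow> f y = Suc (f x) \<or> f x = Suc (f y)"
  shows "full_colourable G (cycle n)"
proof -
  have lt: "f x < n \<and> Suc (f x) \<noteq> n" if "x \<in> verts G" for x using assms(1)[OF that] by simp
  have "full_hom G (cycle n) f"
    unfolding full_hom_def using assms(2) lt by (auto simp: edges_cycle)
  then show ?thesis unfolding full_colourable_def by blast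
qed

section \<open>Path forests\<close>

lemma verts_path_forest [simp]:
  "(i, j) \<in> verts (path_forest ls) \<longleftrightarrow> i < length ls \<and> j < ls ! i"
  by (simp add: path_forest_def verts_def)

lemma edges_path_forest [simp]:
  "((i, j), (i', j')) \<in> edges (path_forest ls) \<longleftrightarrow>
     i = i' \<and> i < length ls \<and> j < ls ! i \<and> j' < ls ! i \<and> (j' = Suc j \<or> j = Suc j')"
  by (simp add: path_forest_def edges_def)

lemma verts_path_forest_Sigma:
  "verts (path_forest ls) = (SIGMA i:{0..<length ls}. {0..<ls ! i})"
  by (auto simp: path_forest_def verts_def)

lemma wf_graph_path_forest: "wf_graph (path_forest ls)"
  unfolding wf_graph_def
proof (intro conjI)
  show "finite (verts (path_forest ls))" unfolding verts_path_forest_Sigma by blast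
qed (auto simp: sym_def irrefl_def)

lemma card_verts_path_forest: "card (verts (path_forest ls)) = sum_list ls"
  unfolding verts_path_forest_Sigma by (simp add: sum_list_sum_nth)

text \<open>A path has one edge less than vertices, counted here in both orientations. An upper
  bound suffices, since edges only help in \<open>cycle_embedding_bound\<close>. Empty paths are
  excluded because \<open>ls ! i - 1\<close> would truncate.\<close>

lemma card_edges_path_forest:
  assumes "0 \<notin> set ls"
  shows "card (edges (path_forest ls)) + 2 * length ls \<le> 2 * sum_list ls"
proof -
  let ?X = "SIGMA i:{0..<length ls}. {0..<ls ! i - 1}"
  let ?f = "\<lambda>(i, j). ((i, j), (i, Suc j))" and ?g = "\<lambda>(i, j). ((i, Suc j), (i, j))"
  have fin: "finite ?X" by blast
  have "edges (path_forest ls) \<subseteq> ?f ` ?X \<union> ?g ` ?X"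
    by (auto simp: image_iff)
  then have "card (edges (path_forest ls)) \<le> card (?f ` ?X \<union> ?g ` ?X)"
    by (rule card_mono[rotated]) (use fin in blast)
  also have "\<dots> \<le> card (?f ` ?X) + card (?g ` ?X)" by (rule card_Un_le)
  also have "\<dots> \<le> card ?X + card ?X"
    by (intro add_mono card_image_le fin)
  finally have "card (edges (path_forest ls)) \<le> 2 * (\<Sum>i=0..<length ls. ls ! i - 1)"
    by simp
  moreover have "(\<Sum>i=0..<length ls. ls ! i) = (\<Sum>i=0..<length ls. Suc (ls ! i - 1))"
  proof (rule sum.cong)
    fix i assume "i \<in> {0..<length ls}"
    then have "ls ! i \<in> set ls" by simp
    then have "ls ! i \<noteq> 0" using assms by metis
    then show "ls ! i = Suc (ls ! i - 1)" by simp
  qed simp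
  moreover have "\<dots> = (\<Sum>i=0..<length ls. ls ! i - 1) + length ls"
    by (subst sum_Suc) simp
  ultimately show ?thesis by (simp add: sum_list_sum_nth)
qed

lemma sum_list_map_Suc: "sum_list (map Suc ls) = sum_list ls + length ls"
  by (induction ls) auto

text \<open>The only twins in a path forest are the two ends of a P_3 and two isolated
  vertices.\<close>

lemma twin_free_path_forest:
  assumes "3 \<notin> set ls"
    and one: "\<And>i i'. i < length ls \<Longrightarrow> i' < length ls \<Longrightarrow> ls ! i = 1 \<Longrightarrow> ls ! i' = 1 \<Longrightarrow> i = i'"
  shows "twin_free (path_forest ls)"
proof -
  have False if x: "(i, j) \<in> verts (path_forest ls)" and y: "(i', j') \<in> verts (path_forest ls)"
    and tw: "\<And>a b. (a, b) \<in> verts (path_forest ls) \<Longrightarrow>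
      ((i, j), (a, b)) \<in> edges (path_forest ls) \<longleftrightarrow> ((i', j'), (a, b)) \<in> edges (path_forest ls)"
    and ne: "i < i' \<or> (i = i' \<and> j < j')" for i j i' j'
  proof (cases "i = i'")
    case True
    have "ls ! i \<noteq> 3" using assms(1) x by (metis nth_mem verts_path_forest)
    then show False
      using True x y ne tw[of i j] tw[of i "j - 1"] tw[of i "Suc j'"] tw[of i 1]
      by (cases j) auto
  next
    case False
    have "\<not> (ls ! i = 1 \<and> ls ! i' = 1)" using one[of i i'] False x y by auto
    then show False
      using False x y tw[of i "j - 1"] tw[of i "Suc j"] tw[of i' "j' - 1"] tw[of i' "Suc j'"]
      by (cases j; cases j') auto
  qed
  note * = this
  show ?thesis
    unfolding twin_free_def
  proof (intro ballI impI, rule ccontr)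
    fix x y
    assume xy: "x \<in> verts (path_forest ls)" "y \<in> verts (path_forest ls)" "x \<noteq> y"
      and tw: "\<forall>z\<in>verts (path_forest ls).
        ((x, z) \<in> edges (path_forest ls)) = ((y, z) \<in> edges (path_forest ls))"
    obtain i j i' j' where "x = (i, j)" "y = (i', j')" by (metis surj_pair)
    moreover have "i < i' \<or> (i = i' \<and> j < j') \<or> i' < i \<or> (i' = i \<and> j' < j)"
      using calculation xy(3) by auto
    ultimately show False using *[of i j i' j'] *[of i' j' i j] xy(1,2) tw by blast
  qed
qed

text \<open>The paths are placed one after the other, each followed by one free vertex of the cycle;
  \<open>off i\<close> is where path \<open>i\<close> starts.\<close>

lemma path_forest_colourable:
  assumes "sum_list (map Suc ls) \<le> n"
  shows "full_colourable (path_forest ls) (cycle n)"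
proof (rule line_colouring)
  define off where "off i = sum_list (map Suc (take i ls))" for i
  have step: "off (Suc i) = off i + Suc (ls ! i)" if "i < length ls" for i
    using that by (simp add: off_def take_Suc_conv_app_nth)
  have le: "off i + Suc (ls ! i) \<le> off i'" if "i < i'" "i' \<le> length ls" for i i'
    using that
  proof (induction i' rule: less_Suc_induct)
    case (1 i) then show ?case using step by simp
  next
    case (2 i j k) then show ?case by simp
  qed
  have tot: "off (length ls) \<le> n" using assms by (simp add: off_def)
  let ?f = "\<lambda>(i, j). off i + j"
  show "?f x + 1 < n" if "x \<in> verts (path_forest ls)" for x
    using that le[of "fst x" "length ls"] tot by (cases x) auto
  show "(x, y) \<in> edges (path_forest ls) \<longleftrightarrow> ?f y = Suc (?f x) \<or> ?f x = Suc (?f y)"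
    if "x \<in> verts (path_forest ls)" "y \<in> verts (path_forest ls)" for x y
  proof -
    obtain i j i' j' where xy: "x = (i, j)" "y = (i', j')" by (metis surj_pair)
    consider "i = i'" | "i < i'" | "i' < i" by linarith
    then show ?thesis
      using that le[of i i'] le[of i' i] xy by cases auto
  qed
qed

lemma path_forest_mset:
  assumes "mset ls = mset ks"
  shows "isomorphic (path_forest ls) (path_forest ks)"
proof -
  obtain f where f: "bij_betw f {..<length ls} {..<length ks}"
    and nth: "\<forall>i<length ls. ls ! i = ks ! f i"
    using permutation_Ex_bij[OF assms] by blast
  have lt: "f i < length ks" if "i < length ls" for i
    using f that by (auto simp: bij_betw_def)
  have inj: "f i = f i' \<longleftrightarrow> i = i'" if "i < length ls" "i' < length ls" for i i'
    using f that by (auto simp: bij_betw_def inj_on_def)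
  have "bij_betw (\<lambda>(i, j). (f i, j)) (verts (path_forest ls)) (verts (path_forest ks))"
    unfolding bij_betw_def
  proof
    show "inj_on (\<lambda>(i, j). (f i, j)) (verts (path_forest ls))"
      by (auto simp: inj_on_def inj)
    have "(a, b) \<in> (\<lambda>(i, j). (f i, j)) ` verts (path_forest ls)"
      if ab: "a < length ks" "b < ks ! a" for a b
    proof -
      obtain i where i: "i < length ls" "f i = a" using f ab(1) by (metis bij_betw_def imageE lessThan_iff)
      then have "(i, b) \<in> verts (path_forest ls)" using nth ab by simp
      then show ?thesis using i(2) by force
    qed
    then show "(\<lambda>(i, j). (f i, j)) ` verts (path_forest ls) = verts (path_forest ks)"
      using lt nth by auto
  qed
  moreover have "\<forall>x\<in>verts (path_forest ls). \<forall>y\<in>verts (path_forest ls).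
     (x, y) \<in> edges (path_forest ls) \<longleftrightarrow>
     ((case x of (i, j) \<Rightarrow> (f i, j)), (case y of (i, j) \<Rightarrow> (f i, j))) \<in> edges (path_forest ks)"
    using lt nth inj by auto
  ultimately show ?thesis unfolding isomorphic_def by blast
qed

text \<open>Only a pair that \<open>v\<close> alone told apart can become twins, that is, a
  neighbour \<open>x\<close> and a non-neighbour \<open>y\<close> of \<open>v\<close>.\<close>

lemma twin_free_delete:
  assumes "twin_free G" "wf_graph G"
    and "\<And>x y. (v, x) \<in> edges G \<Longrightarrow> y \<in> verts G \<Longrightarrow> (y, v) \<notin> edges G \<Longrightarrow> y \<noteq> v \<Longrightarrow> x \<noteq> y \<Longrightarrow>
           \<exists>z\<in>verts G. z \<noteq> v \<and> ((x, z) \<in> edges G) \<noteq> ((y, z) \<in> edges G)"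
  shows "twin_free (induced G (verts G - {v}))"
  unfolding twin_free_def
proof (intro ballI impI, rule ccontr)
  fix x y
  assume "x \<in> verts (induced G (verts G - {v}))" "y \<in> verts (induced G (verts G - {v}))"
    and "\<forall>z\<in>verts (induced G (verts G - {v})).
      ((x, z) \<in> edges (induced G (verts G - {v}))) = ((y, z) \<in> edges (induced G (verts G - {v})))"
    and ne: "x \<noteq> y"
  then have xy: "x \<in> verts G" "y \<in> verts G" "x \<noteq> v" "y \<noteq> v"
    and tw: "\<And>z. z \<in> verts G \<Longrightarrow> z \<noteq> v \<Longrightarrow> (x, z) \<in> edges G \<longleftrightarrow> (y, z) \<in> edges G"
    by auto
  have "(x, v) \<in> edges G \<and> (y, v) \<notin> edges G \<or> (y, v) \<in> edges G \<and> (x, v) \<notin> edges G"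
    using assms(1) xy tw ne unfolding twin_free_def by metis
  then show False
    using assms(3)[of x y] assms(3)[of y x] xy tw ne wf_graph_sym[OF assms(2)] by metis
qed

text \<open>The doubled width drops by 4 with the vertex and rises by the ordered edges lost.
  \<open>D\<close> collects known edges at \<open>v\<close>, so \<open>card D\<close> is at most
  twice its degree.\<close>

lemma path_forest_delete_bound:
  assumes "twin_free (induced (path_forest ls) (verts (path_forest ls) - {v}))"
    and "full_colourable (induced (path_forest ls) (verts (path_forest ls) - {v})) (cycle n)"
    and "n \<ge> 3" "0 \<notin> set ls" "v \<in> verts (path_forest ls)"
    and D: "D \<subseteq> edges (path_forest ls)" "\<And>x y. (x, y) \<in> D \<Longrightarrow> x = v \<or> y = v"
  shows "2 * sum_list (map Suc ls) + card D \<le> 2 * n + 4"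
proof -
  let ?G = "path_forest ls" and ?H = "induced (path_forest ls) (verts (path_forest ls) - {v})"
  have wf: "wf_graph ?H" by (rule wf_graph_induced[OF wf_graph_path_forest]) blast
  have "\<not> card (edges ?H) + 2 * n < 4 * card (verts ?H)"
    using not_colourable_of_card[OF wf assms(1,3)] assms(2) by blast
  moreover have "card (verts ?H) = sum_list ls - 1"
    using assms(5) by (simp add: card_verts_path_forest)
  moreover have fin: "finite (edges ?G)" by (rule finite_edges[OF wf_graph_path_forest])
  have "card (edges ?H) \<le> card (edges ?G - D)"
    by (rule card_mono) (use fin D(2) in \<open>auto simp: edges_induced_eq\<close>)
  moreover have "card (edges ?G - D) = card (edges ?G) - card D"
    by (rule card_Diff_subset) (use D(1) fin finite_subset in auto)
  moreover have "card D \<le> card (edges ?G)" using D(1) fin by (rule card_mono[rotated])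
  ultimately show ?thesis
    using card_edges_path_forest[OF assms(4)] by (simp add: sum_list_map_Suc)
qed

section \<open>Path forests that are minimal obstructions\<close>

lemma mset_lengths:
  assumes "set ls \<subseteq> {1, 2, 4, 6}"
  shows "mset ls = mset (replicate (count (mset ls) 1) 1 @ replicate (count (mset ls) 2) 2 @
           replicate (count (mset ls) 4) 4 @ replicate (count (mset ls) 6) (6::nat))"
proof (rule multiset_eqI)
  fix x
  show "count (mset ls) x = count (mset (replicate (count (mset ls) 1) 1 @
      replicate (count (mset ls) 2) 2 @ replicate (count (mset ls) 4) 4 @
      replicate (count (mset ls) 6) (6::nat))) x"
    using assms by (cases "x \<in> set ls") (auto simp: count_mset_0_iff)
qed

lemma count_one_le:
  assumes "\<And>i i'. i < length ls \<Longrightarrow> i' < length ls \<Longrightarrow> ls ! i = a \<Longrightarrow> ls ! i' = a \<Longrightarrow> i = i'"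
  shows "count (mset ls) a \<le> 1"
proof -
  have "count (mset ls) a = card {i. i < length ls \<and> ls ! i = a}"
    unfolding count_mset count_list_eq_length_filter length_filter_conv_card
    by (rule arg_cong[of _ _ card]) auto
  moreover have "card {i. i < length ls \<and> ls ! i = a} \<le> 1"
    using assms by (simp add: card_le_Suc0_iff_eq)
  ultimately show ?thesis by simp
qed

context
  fixes n :: nat and ls :: "nat list"
  assumes n: "n \<ge> 5" and obs: "min_obstruction (path_forest ls) (cycle n)" and nz: "0 \<notin> set ls"
begin

lemma obs_twin_free: "twin_free (path_forest ls)"
  using min_obstruction_twin_free[OF wf_graph_path_forest obs] cycle_irrefl n by simp

lemma obs_width_gt: "n < sum_list (map Suc ls)"
  using path_forest_colourable[of ls n] obs unfolding min_obstruction_def by (meson not_le)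

text \<open>Coordinate form of the two preceding deletion lemmas. The bound contradicts
  \<open>obs_width_gt\<close> as soon as \<open>card D = 4\<close>, that is, when a vertex of degree
  two can be deleted without creating twins.\<close>

lemma obs_delete:
  assumes v: "(i, j) \<in> verts (path_forest ls)"
    and D: "D \<subseteq> edges (path_forest ls)" "\<And>x y. (x, y) \<in> D \<Longrightarrow> x = (i, j) \<or> y = (i, j)"
    and tf: "\<And>b a' b'. ((i, j), (i, b)) \<in> edges (path_forest ls) \<Longrightarrow>
        (a', b') \<in> verts (path_forest ls) \<Longrightarrow> ((a', b'), (i, j)) \<notin> edges (path_forest ls) \<Longrightarrow>
        (a', b') \<noteq> (i, j) \<Longrightarrow> (a', b') \<noteq> (i, b) \<Longrightarrow>
        \<exists>a'' b''. (a'', b'') \<in> verts (path_forest ls) \<and> (a'', b'') \<noteq> (i, j) \<and>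
          (((i, b), (a'', b'')) \<in> edges (path_forest ls)) \<noteq> (((a', b'), (a'', b'')) \<in> edges (path_forest ls))"
  shows "2 * sum_list (map Suc ls) + card D \<le> 2 * n + 4"
proof (rule path_forest_delete_bound[OF _ _ _ nz v D])
  show "twin_free (induced (path_forest ls) (verts (path_forest ls) - {(i, j)}))"
  proof (rule twin_free_delete[OF obs_twin_free wf_graph_path_forest])
    fix x y
    assume *: "((i, j), x) \<in> edges (path_forest ls)" "y \<in> verts (path_forest ls)"
      "(y, (i, j)) \<notin> edges (path_forest ls)" "y \<noteq> (i, j)" "x \<noteq> y"
    obtain a b a' b' where xy: "x = (a, b)" "y = (a', b')" by (metis surj_pair)
    have a: "a = i" using *(1) xy by simp
    show "\<exists>z\<in>verts (path_forest ls). z \<noteq> (i, j) \<and>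
        ((x, z) \<in> edges (path_forest ls)) \<noteq> ((y, z) \<in> edges (path_forest ls))"
      using tf[of b a' b'] * xy a by blast
  qed
  show "full_colourable (induced (path_forest ls) (verts (path_forest ls) - {(i, j)})) (cycle n)"
    using obs v unfolding min_obstruction_def by blast
qed (use n in auto)

lemma obs_one: "i < length ls \<Longrightarrow> i' < length ls \<Longrightarrow> ls ! i = 1 \<Longrightarrow> ls ! i' = 1 \<Longrightarrow> i = i'"
proof -
  assume *: "i < length ls" "i' < length ls" "ls ! i = 1" "ls ! i' = 1"
  have "(i, 0) = (i', 0::nat)"
    using obs_twin_free * unfolding twin_free_def
    by (elim ballE[of _ _ "(i, 0)"] ballE[of _ _ "(i', 0)"]) auto
  then show ?thesis by simp
qed

lemma obs_not_three: "i < length ls \<Longrightarrow> ls ! i \<noteq> 3"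
proof
  assume *: "i < length ls" "ls ! i = 3"
  have "(i, 0) = (i, 2::nat)"
    using obs_twin_free * unfolding twin_free_def
    by (elim ballE[of _ _ "(i, 0)"] ballE[of _ _ "(i, 2)"]) auto
  then show False by simp
qed

text \<open>A path of l vertices loses its vertex 2 and splits into K_2 and a path of l - 3
  vertices. For l = 5 or l > 6 the latter is neither K_1 nor P_3, so no twins arise although the
  deleted vertex has degree two.\<close>

lemma obs_path_length:
  assumes i: "i < length ls"
  shows "ls ! i \<in> {1, 2, 4, 6}"
proof (rule ccontr)
  assume *: "ls ! i \<notin> {1, 2, 4, 6}"
  have "ls ! i \<noteq> 0" using nz i by (metis nth_mem)
  then have l: "ls ! i \<ge> 5" "ls ! i \<noteq> 6" using * obs_not_three[OF i] by auto
  let ?D = "{((i, 2), (i, 1)), ((i, 1), (i, 2)), ((i, 2), (i, 3)), ((i, 3), (i, 2))} :: ((nat \<times> nat) \<times> (nat \<times> nat)) set"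
  have "2 * sum_list (map Suc ls) + card ?D \<le> 2 * n + 4"
  proof (rule obs_delete[of i 2])
    fix b a' b'
    assume 1: "((i, 2), (i, b)) \<in> edges (path_forest ls)" "(a', b') \<in> verts (path_forest ls)"
      "((a', b'), (i, 2)) \<notin> edges (path_forest ls)" "(a', b') \<noteq> (i, 2)" "(a', b') \<noteq> (i, b)"
    \<comment> \<open>Vertex 1 keeps 0 as a neighbour of its own. Vertex 3 keeps 4, shared only with
      5; if 5 exists then so does 6, as length 6 is excluded, and 6 separates 3 from 5.\<close>
    then consider "b = 1" | "b = 3" "(a', b') = (i, 5)" | "b = 3" "(a', b') \<noteq> (i, 5)"
      using l by fastforce
    then show "\<exists>a'' b''. (a'', b'') \<in> verts (path_forest ls) \<and> (a'', b'') \<noteq> (i, 2) \<and>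
      (((i, b), (a'', b'')) \<in> edges (path_forest ls)) \<noteq> (((a', b'), (a'', b'')) \<in> edges (path_forest ls))"
    proof cases
      case 1 then show ?thesis
        using \<open>(a', b') \<noteq> (i, b)\<close> i l by (intro exI[of _ i] exI[of _ 0]) auto
    next
      case 2 then show ?thesis
        using \<open>(a', b') \<in> _\<close> i l by (intro exI[of _ i] exI[of _ 6]) auto
    next
      case 3 then show ?thesis
        using \<open>(a', b') \<noteq> (i, b)\<close> i l by (intro exI[of _ i] exI[of _ 4]) auto
    qed
  qed (use i l in auto)
  then show False using obs_width_gt by simp
qed

lemma obs_nbr:
  assumes "(a, b) \<in> verts (path_forest ls)" "ls ! a \<noteq> 1"
  obtains c where "((a, b), (a, c)) \<in> edges (path_forest ls)"
proof (cases b)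
  case 0 then show ?thesis using assms that[of 1] by auto
next
  case (Suc c) then show ?thesis using assms that[of c] by auto
qed

text \<open>Without a K_1, deleting vertex 1 of a P_4 or P_6 creates a single isolated vertex and
  hence no twins, so only copies of K_2 remain. Deleting an end of one of these then caps the width
  at n + 1.\<close>

lemma obs_no_one:
  assumes no: "1 \<notin> set ls"
  shows "set ls \<subseteq> {2} \<and> sum_list (map Suc ls) = n + 1"
proof -
  have ne1: "ls ! a \<noteq> 1" if "a < length ls" for a using no that by (metis nth_mem)
  have two: "ls ! i = 2" if i: "i < length ls" for i
  proof (rule ccontr)
    assume "ls ! i \<noteq> 2"
    then have l: "ls ! i = 4 \<or> ls ! i = 6" using ne1[OF i] obs_path_length[OF i] by auto
    let ?D = "{((i, 1), (i, 0)), ((i, 0), (i, 1)), ((i, 1), (i, 2)), ((i, 2), (i, 1))} :: ((nat \<times> nat) \<times> (nat \<times> nat)) set"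
    have "2 * sum_list (map Suc ls) + card ?D \<le> 2 * n + 4"
    proof (rule obs_delete[of i 1])
      fix b a' b'
      assume 1: "((i, 1), (i, b)) \<in> edges (path_forest ls)" "(a', b') \<in> verts (path_forest ls)"
        "((a', b'), (i, 1)) \<notin> edges (path_forest ls)" "(a', b') \<noteq> (i, 1)" "(a', b') \<noteq> (i, b)"
      then consider "b = 0" | "b = 2" "(a', b') = (i, 4)" | "b = 2" "(a', b') \<noteq> (i, 4)"
        using l by fastforce
      then show "\<exists>a'' b''. (a'', b'') \<in> verts (path_forest ls) \<and> (a'', b'') \<noteq> (i, 1) \<and>
        (((i, b), (a'', b'')) \<in> edges (path_forest ls)) \<noteq> (((a', b'), (a'', b'')) \<in> edges (path_forest ls))"
      proof cases
        case 1
        \<comment> \<open>Vertex 0 becomes isolated, while every other vertex still has a neighbour,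
          since no path has length 1.\<close>
        obtain c where "((a', b'), (a', c)) \<in> edges (path_forest ls)"
          using obs_nbr ne1 \<open>(a', b') \<in> _\<close> by (metis verts_path_forest)
        then show ?thesis
          using \<open>((a', b'), (i, 1)) \<notin> _\<close> 1 by (intro exI[of _ a'] exI[of _ c]) auto
      next
        case 2 then show ?thesis
          using \<open>(a', b') \<in> _\<close> i l by (intro exI[of _ i] exI[of _ 5]) auto
      next
        case 3 then show ?thesis
          using \<open>(a', b') \<noteq> (i, b)\<close> i l by (intro exI[of _ i] exI[of _ 3]) auto
      qed
    qed (use i l in auto)
    then show False using obs_width_gt by simp
  qed
  have "ls \<noteq> []" using obs_width_gt by auto
  then have i: "0 < length ls" by simp
  let ?D = "{((0, 0), (0, 1)), ((0, 1), (0, 0))} :: ((nat \<times> nat) \<times> (nat \<times> nat)) set"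
  have "2 * sum_list (map Suc ls) + card ?D \<le> 2 * n + 4"
  proof (rule obs_delete[of 0 0])
    fix b a' b'
    assume 1: "((0, 0), (0, b)) \<in> edges (path_forest ls)" "(a', b') \<in> verts (path_forest ls)"
      "((a', b'), (0, 0)) \<notin> edges (path_forest ls)" "(a', b') \<noteq> (0, 0)" "(a', b') \<noteq> (0, b)"
    obtain c where "((a', b'), (a', c)) \<in> edges (path_forest ls)"
      using obs_nbr ne1 1(2) by (metis verts_path_forest)
    then show "\<exists>a'' b''. (a'', b'') \<in> verts (path_forest ls) \<and> (a'', b'') \<noteq> (0, 0) \<and>
        (((0, b), (a'', b'')) \<in> edges (path_forest ls)) \<noteq> (((a', b'), (a'', b'')) \<in> edges (path_forest ls))"
      using 1 two[OF i] by (intro exI[of _ a'] exI[of _ c]) auto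
  qed (use i two[OF i] in auto)
  then have "sum_list (map Suc ls) = n + 1" using obs_width_gt by simp
  moreover have "set ls \<subseteq> {2}" using two by (auto simp: in_set_conv_nth)
  ultimately show ?thesis by blast
qed

text \<open>The isolated vertex is deleted: no vertex loses a neighbour, so no twins arise and
  \<open>D\<close> is empty.\<close>

lemma obs_with_one:
  assumes "1 \<in> set ls"
  shows "sum_list (map Suc ls) \<le> n + 2"
proof -
  obtain i where i: "i < length ls" "ls ! i = 1" using assms by (auto simp: in_set_conv_nth)
  have "2 * sum_list (map Suc ls) + card ({} :: ((nat \<times> nat) \<times> (nat \<times> nat)) set) \<le> 2 * n + 4"
    by (rule obs_delete[of i 0]) (use i in auto)
  then show ?thesis by simp
qed

text \<open>Deleting an end of P_6 leaves the twin-free P_5 and costs one edge. The same deletion in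
  P_4 would leave P_3, which is why P_4 is compatible with width n + 2.\<close>

lemma obs_with_six:
  assumes "6 \<in> set ls"
  shows "sum_list (map Suc ls) \<le> n + 1"
proof -
  obtain i where i: "i < length ls" "ls ! i = 6" using assms by (auto simp: in_set_conv_nth)
  let ?D = "{((i, 0), (i, 1)), ((i, 1), (i, 0))} :: ((nat \<times> nat) \<times> (nat \<times> nat)) set"
  have "2 * sum_list (map Suc ls) + card ?D \<le> 2 * n + 4"
  proof (rule obs_delete[of i 0])
    fix b a' b'
    assume 1: "((i, 0), (i, b)) \<in> edges (path_forest ls)" "(a', b') \<in> verts (path_forest ls)"
      "((a', b'), (i, 0)) \<notin> edges (path_forest ls)" "(a', b') \<noteq> (i, 0)" "(a', b') \<noteq> (i, b)"
    show "\<exists>a'' b''. (a'', b'') \<in> verts (path_forest ls) \<and> (a'', b'') \<noteq> (i, 0) \<and>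
        (((i, b), (a'', b'')) \<in> edges (path_forest ls)) \<noteq> (((a', b'), (a'', b'')) \<in> edges (path_forest ls))"
    proof (cases "(a', b') = (i, 3)")
      case True then show ?thesis using 1 i by (intro exI[of _ i] exI[of _ 4]) auto
    next
      case False then show ?thesis using 1 i by (intro exI[of _ i] exI[of _ 2]) auto
    qed
  qed (use i in auto)
  then show ?thesis by simp
qed

lemma obs_path_forest_in_LF: "in_LF (n - 1) (path_forest ls)"
proof -
  define m1 m2 m4 m6 where "m1 = count (mset ls) 1" and "m2 = count (mset ls) 2"
    and "m4 = count (mset ls) 4" and "m6 = count (mset ls) 6"
  let ?ks = "replicate m1 1 @ replicate m2 2 @ replicate m4 4 @ replicate m6 (6::nat)"
  have "set ls \<subseteq> {1, 2, 4, 6}" using obs_path_length by (metis in_set_conv_nth subsetI)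
  then have ms: "mset ls = mset ?ks" unfolding m1_def m2_def m4_def m6_def by (rule mset_lengths)
  then have iso: "isomorphic (path_forest ls) (path_forest ?ks)" by (rule path_forest_mset)
  have "sum_mset (mset ls) = sum_mset (mset ?ks)" "size (mset ls) = size (mset ?ks)"
    using ms by auto
  then have "sum_list ls = sum_list ?ks" "length ls = length ?ks"
    by (simp_all only: sum_mset_sum_list size_mset)
  then have w: "sum_list (map Suc ls) = 2 * m1 + 3 * m2 + 5 * m4 + 7 * m6"
    unfolding sum_list_map_Suc by (simp add: sum_list_replicate)
  show ?thesis
  proof (cases "1 \<in> set ls")
    case False
    then have "m1 = 0" "m4 = 0" "m6 = 0" "sum_list (map Suc ls) = n + 1"
      using obs_no_one unfolding m1_def m4_def m6_def by (auto simp: count_mset_0_iff)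
    then show ?thesis using iso w n unfolding in_LF_def by auto
  next
    case True
    then have "m1 \<noteq> 0" by (simp add: m1_def count_mset_0_iff)
    moreover have "m1 \<le> 1" unfolding m1_def using obs_one by (intro count_one_le)
    ultimately have m1: "m1 = 1" by simp
    have bd: "n < sum_list (map Suc ls)" "sum_list (map Suc ls) \<le> n + 2"
      using obs_width_gt obs_with_one True by auto
    \<comment> \<open>Width n + 1 gives the third family; width n + 2 excludes P_6 and gives the
      second.\<close>
    show ?thesis
    proof (cases "sum_list (map Suc ls) = n + 1")
      case True
      then have "3 * m2 + 5 * m4 + 7 * m6 = n - 1" using w m1 n by simp
      then show ?thesis using iso m1 unfolding in_LF_def by auto
    next
      case False
      then have "6 \<notin> set ls" using obs_with_six bd by force
      then have "m6 = 0" by (simp add: m6_def count_mset_0_iff)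
      moreover have "3 * m2 + 5 * m4 = n - 1 + 1" using False bd w m1 n calculation by simp
      ultimately show ?thesis using iso m1 unfolding in_LF_def by auto
    qed
  qed
qed

end

section \<open>Colouring path forests with a vertex deleted\<close>

lemma path_forest_not_colourable:
  assumes "n \<ge> 3" "twin_free (path_forest ls)" "0 \<notin> set ls" "n < sum_list (map Suc ls)"
  shows "\<not> full_colourable (path_forest ls) (cycle n)"
  using not_colourable_of_card[OF wf_graph_path_forest assms(2,1)] card_edges_path_forest[OF assms(3)]
    assms(4) by (simp add: card_verts_path_forest sum_list_map_Suc)

text \<open>The map \<open>h\<close> folds what remains of path \<open>i\<close> after deleting its vertex \<open>j\<close> onto a path
  with \<open>l\<close> vertices; value \<open>None\<close> identifies a vertex with the isolated vertex \<open>(0, 0)\<close>.\<close>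

lemma path_forest_fold:
  assumes i: "i < length ls" and w: "sum_list (map Suc ls) + l \<le> n + ls ! i"
    and h: "\<forall>b<ls ! i. b \<noteq> j \<longrightarrow> (case h b of None \<Rightarrow> ls ! 0 = 1 \<and> i \<noteq> 0 | Some c \<Rightarrow> c < l)"
    and adj: "\<forall>b<ls ! i. \<forall>b'<ls ! i. b \<noteq> j \<longrightarrow> b' \<noteq> j \<longrightarrow>
       (b' = Suc b \<or> b = Suc b') =
       (\<exists>c c'. h b = Some c \<and> h b' = Some c' \<and> (c' = Suc c \<or> c = Suc c'))"
  shows "full_colourable (induced (path_forest ls) (verts (path_forest ls) - {(i, j)})) (cycle n)"
proof (rule full_colourable_comp)
  let ?g = "\<lambda>b. case h b of None \<Rightarrow> (0, 0) | Some c \<Rightarrow> (i, c)"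
  let ?f = "\<lambda>(a, b). if a = i then ?g b else (a, b)"
  let ?G = "induced (path_forest ls) (verts (path_forest ls) - {(i, j)})"
  \<comment> \<open>Assumption \<open>w\<close> says precisely that the forest with path
    \<open>i\<close> shortened to \<open>l\<close> vertices has width at most
    \<open>n\<close>.\<close>
  have "sum_list (map Suc (ls[i := l])) + ls ! i = sum_list (map Suc ls) + l"
    using i elem_le_sum_list[of i ls] by (simp add: sum_list_map_Suc sum_list_update)
  then show "full_colourable (path_forest (ls[i := l])) (cycle n)"
    using w by (intro path_forest_colourable) simp
  have h': "(h b = None \<and> ls ! 0 = 1 \<and> i \<noteq> 0) \<or> (\<exists>c<l. h b = Some c)"
    if "b < ls ! i" "b \<noteq> j" for b
    using h that by (cases "h b") auto
  have 1: "?f x \<in> verts (path_forest (ls[i := l]))" if "x \<in> verts ?G" for x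
  proof -
    obtain a b where x: "x = (a, b)" by fastforce
    then show ?thesis using that h'[of b] i by (cases "a = i") (auto simp: gr_implies_not0)
  qed
  have 2: "(x, y) \<in> edges ?G \<longleftrightarrow> (?f x, ?f y) \<in> edges (path_forest (ls[i := l]))"
    if "x \<in> verts ?G" "y \<in> verts ?G" for x y
  proof -
    obtain a b a' b' where xy: "x = (a, b)" "y = (a', b')" by (metis surj_pair)
    have sym: "(c, d) \<in> edges (path_forest ks) \<longleftrightarrow> (d, c) \<in> edges (path_forest ks)" for c d ks
      using wf_graph_sym[OF wf_graph_path_forest] by blast
    have cross: "(?g b, (a', b')) \<notin> edges (path_forest (ls[i := l]))"
      if "b < ls ! i" "b \<noteq> j" "a' \<noteq> i" for b a' b'
      using h'[OF that(1,2)] that(3) by auto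
    show ?thesis
    proof (cases "a = i"; cases "a' = i")
      assume a: "a = i" "a' = i"
      then have b: "b < ls ! i" "b' < ls ! i" "b \<noteq> j" "b' \<noteq> j" using that xy by auto
      have "(x, y) \<in> edges ?G \<longleftrightarrow> b' = Suc b \<or> b = Suc b'" using that xy a by auto
      also have "\<dots> \<longleftrightarrow> (\<exists>c c'. h b = Some c \<and> h b' = Some c' \<and> (c' = Suc c \<or> c = Suc c'))"
        using adj b by blast
      also have "\<dots> \<longleftrightarrow> (?g b, ?g b') \<in> edges (path_forest (ls[i := l]))"
        using h'[OF b(1,3)] h'[OF b(2,4)] i by auto
      finally show ?thesis using xy a by simp
    next
      assume a: "a = i" "a' \<noteq> i"
      then show ?thesis using cross[of b a' b'] that xy by auto
    next
      assume a: "a \<noteq> i" "a' = i"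
      then show ?thesis using cross[of b' a b] that xy sym[of "(a, b)" "?g b'"] by auto
    next
      assume a: "a \<noteq> i" "a' \<noteq> i"
      then show ?thesis using that xy by auto
    qed
  qed
  show "full_hom ?G (path_forest (ls[i := l])) ?f"
    unfolding full_hom_def using 1 2 by blast
qed

lemma path_forest_delete_first:
  assumes "sum_list (map Suc ls) \<le> n"
  shows "full_colourable (induced (path_forest (1 # ls)) (verts (path_forest (1 # ls)) - {(0, 0)})) (cycle n)"
proof (rule full_colourable_comp)
  show "full_colourable (path_forest ls) (cycle n)" using assms by (rule path_forest_colourable)
  show "full_hom (induced (path_forest (1 # ls)) (verts (path_forest (1 # ls)) - {(0, 0)}))
      (path_forest ls) (\<lambda>(a, b). (a - 1, b))" (is "full_hom ?G _ ?f")
  proof -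
    have *: "\<exists>a b. x = (Suc a, b) \<and> a < length ls \<and> b < ls ! a" if "x \<in> verts ?G" for x
    proof -
      obtain a b where "x = (a, b)" by fastforce
      then show ?thesis using that by (cases a) auto
    qed
    have "?f x \<in> verts (path_forest ls)" if "x \<in> verts ?G" for x
      using *[OF that] by auto
    moreover have "(x, y) \<in> edges ?G \<longleftrightarrow> (?f x, ?f y) \<in> edges (path_forest ls)"
      if "x \<in> verts ?G" "y \<in> verts ?G" for x y
      using *[OF that(1)] *[OF that(2)] by auto
    ultimately show ?thesis unfolding full_hom_def by blast
  qed
qed

text \<open>The forest has width n + 2 or n + 1, the latter if a P_6 occurs, so each deletion must
  save 2 or 1 positions. Deleting the K_1 saves 2. A remnant of K_2 is absorbed by the K_1, leaving
  an empty path (\<open>l = 0\<close>), and a remnant of P_4 folds onto K_2: both save 2. A remnant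
  of P_6 needs five positions and saves 1.\<close>

lemma min_obstruction_with_one:
  assumes "n \<ge> 3" and ks: "set ks \<subseteq> {2, 4, 6}"
    and w: "sum_list (map Suc ks) = n \<or> sum_list (map Suc ks) + 1 = n"
    and six: "6 \<in> set ks \<Longrightarrow> sum_list (map Suc ks) + 1 = n"
  shows "min_obstruction (path_forest (1 # ks)) (cycle n)"
proof (rule min_obstructionI)
  let ?ls = "1 # ks"
  have len: "?ls ! i \<in> {2, 4, 6}" if "i < length ?ls" "i \<noteq> 0" for i
    using that ks by (metis Suc_less_eq length_Cons not0_implies_Suc nth_Cons_Suc nth_mem subsetD)
  have "twin_free (path_forest ?ls)"
  proof (rule twin_free_path_forest)
    show "3 \<notin> set ?ls" using ks by auto
    fix i i' assume "i < length ?ls" "i' < length ?ls" "?ls ! i = 1" "?ls ! i' = 1"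
    then show "i = i'" using len[of i] len[of i'] by (cases "i = 0"; cases "i' = 0") auto
  qed
  then show "\<not> full_colourable (path_forest ?ls) (cycle n)"
    by (rule path_forest_not_colourable[OF assms(1)]) (use w ks in auto)
  fix v assume v: "v \<in> verts (path_forest ?ls)"
  obtain i j where ij: "v = (i, j)" by fastforce
  have i: "i < length ?ls" and j: "j < ?ls ! i" using v ij by auto
  show "full_colourable (induced (path_forest ?ls) (verts (path_forest ?ls) - {v})) (cycle n)"
  proof (cases "i = 0")
    case True
    then have "v = (0, 0)" using ij j by simp
    then show ?thesis using w path_forest_delete_first[of ks n] by auto
  next
    case False
    have w': "sum_list (map Suc ?ls) \<le> n + 2" using w by auto
    consider "?ls ! i = 2" | "?ls ! i = 4" | "?ls ! i = 6" using len[OF i False] by auto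
    then show ?thesis
    proof cases
      case 1
      then have "j = 0 \<or> j = 1" using j by auto
      then show ?thesis
        unfolding ij using False w' 1
        by (intro path_forest_fold[OF i, where l = 0 and h = "\<lambda>b. None"]) auto
    next
      case 2
      \<comment> \<open>There remains P_3, folded by identifying its ends, or K_1 + K_2, whose
        isolated vertex goes to \<open>None\<close>.\<close>
      have "\<exists>h. (\<forall>b<4. b \<noteq> j \<longrightarrow> (case h b of None \<Rightarrow> True | Some c \<Rightarrow> c < 2)) \<and>
        (\<forall>b<4. \<forall>b'<4. b \<noteq> j \<longrightarrow> b' \<noteq> j \<longrightarrow> (b' = Suc b \<or> b = Suc b') =
          (\<exists>c c'. h b = Some c \<and> h b' = Some c' \<and> (c' = Suc c \<or> c = Suc c')))"
      proof -
        consider "j = 0" | "j = 1" | "j = 2" | "j = 3" using 2 j by linarith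
        then show ?thesis
        proof cases
          case 1 then show ?thesis
            by (intro exI[of _ "\<lambda>b. Some (if b = 2 then 1 else 0)"])
              (simp add: numeral_eq_Suc All_less_Suc)
        next
          case 2 then show ?thesis
            by (intro exI[of _ "\<lambda>b. if b = 0 then None else Some (b - 2)"])
              (simp add: numeral_eq_Suc All_less_Suc)
        next
          case 3 then show ?thesis
            by (intro exI[of _ "\<lambda>b. if b = 3 then None else Some b"])
              (simp add: numeral_eq_Suc All_less_Suc)
        next
          case 4 then show ?thesis
            by (intro exI[of _ "\<lambda>b. Some (if b = 1 then 1 else 0)"])
              (simp add: numeral_eq_Suc All_less_Suc)
        qed
      qed
      then obtain h where h: "\<forall>b<4. b \<noteq> j \<longrightarrow> (case h b of None \<Rightarrow> True | Some c \<Rightarrow> c < 2)"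
        "\<forall>b<4. \<forall>b'<4. b \<noteq> j \<longrightarrow> b' \<noteq> j \<longrightarrow> (b' = Suc b \<or> b = Suc b') =
          (\<exists>c c'. h b = Some c \<and> h b' = Some c' \<and> (c' = Suc c \<or> c = Suc c'))"
        by blast
      show ?thesis unfolding ij
      proof (rule path_forest_fold[OF i, where l = 2 and h = h])
        show "sum_list (map Suc ?ls) + 2 \<le> n + ?ls ! i" using w' 2 by simp
        show "\<forall>b<?ls ! i. b \<noteq> j \<longrightarrow> (case h b of None \<Rightarrow> ?ls ! 0 = 1 \<and> i \<noteq> 0 | Some c \<Rightarrow> c < 2)"
          using h(1) False unfolding 2 by (auto split: option.splits)
      qed (use h(2) in \<open>simp only: 2\<close>)
    next
      case 3
      then have "6 \<in> set ks" using i False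
        by (metis Suc_less_eq length_Cons not0_implies_Suc nth_Cons_Suc nth_mem)
      then have w'': "sum_list (map Suc ?ls) \<le> n + 1" using six by auto
      \<comment> \<open>There remains P_5, which has no fold and dictates the 5, or K_1 + P_4, or
        K_2 + P_3; in the last case the P_3 is folded to an edge and placed one gap away from the
        K_2.\<close>
      have "\<exists>h. (\<forall>b<6. b \<noteq> j \<longrightarrow> (case h b of None \<Rightarrow> True | Some c \<Rightarrow> c < 5)) \<and>
        (\<forall>b<6. \<forall>b'<6. b \<noteq> j \<longrightarrow> b' \<noteq> j \<longrightarrow> (b' = Suc b \<or> b = Suc b') =
          (\<exists>c c'. h b = Some c \<and> h b' = Some c' \<and> (c' = Suc c \<or> c = Suc c')))"
      proof -
        consider "j = 0" | "j = 1" | "j = 2" | "j = 3" | "j = 4" | "j = 5" using 3 j by linarith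
        then show ?thesis
        proof cases
          case 1 then show ?thesis
            by (intro exI[of _ "\<lambda>b. Some (b - 1)"]) (simp add: numeral_eq_Suc All_less_Suc)
        next
          case 2 then show ?thesis
            by (intro exI[of _ "\<lambda>b. if b = 0 then None else Some (b - 2)"])
              (simp add: numeral_eq_Suc All_less_Suc)
        next
          case 3 then show ?thesis
            by (intro exI[of _ "\<lambda>b. Some (if b = 5 then 3 else b)"])
              (simp add: numeral_eq_Suc All_less_Suc)
        next
          case 4 then show ?thesis
            by (intro exI[of _ "\<lambda>b. Some (if b = 2 then 0 else if b \<ge> 4 then b - 1 else b)"])
              (simp add: numeral_eq_Suc All_less_Suc)
        next
          case 5 then show ?thesis
            by (intro exI[of _ "\<lambda>b. if b = 5 then None else Some b"])
              (simp add: numeral_eq_Suc All_less_Suc)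
        next
          case 6 then show ?thesis
            by (intro exI[of _ "\<lambda>b. Some b"]) (simp add: numeral_eq_Suc All_less_Suc)
        qed
      qed
      then obtain h where h: "\<forall>b<6. b \<noteq> j \<longrightarrow> (case h b of None \<Rightarrow> True | Some c \<Rightarrow> c < 5)"
        "\<forall>b<6. \<forall>b'<6. b \<noteq> j \<longrightarrow> b' \<noteq> j \<longrightarrow> (b' = Suc b \<or> b = Suc b') =
          (\<exists>c c'. h b = Some c \<and> h b' = Some c' \<and> (c' = Suc c \<or> c = Suc c'))"
        by blast
      show ?thesis unfolding ij
      proof (rule path_forest_fold[OF i, where l = 5 and h = h])
        show "sum_list (map Suc ?ls) + 5 \<le> n + ?ls ! i" using w'' 3 by simp
        show "\<forall>b<?ls ! i. b \<noteq> j \<longrightarrow> (case h b of None \<Rightarrow> ?ls ! 0 = 1 \<and> i \<noteq> 0 | Some c \<Rightarrow> c < 5)"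
          using h(1) False unfolding 3 by (auto split: option.splits)
      qed (use h(2) in \<open>simp only: 3\<close>)
    qed
  qed
qed

text \<open>No K_1 can absorb the remaining vertex here, but the width is n + 1 and shrinking K_2 to
  K_1 saves the one position needed.\<close>

lemma min_obstruction_twos:
  assumes "n \<ge> 3" "3 * m = n + 1"
  shows "min_obstruction (path_forest (replicate m 2)) (cycle n)"
proof (rule min_obstructionI)
  let ?ls = "replicate m (2::nat)"
  have w: "sum_list (map Suc ?ls) = n + 1" using assms(2) by (simp add: sum_list_replicate)
  have "twin_free (path_forest ?ls)" by (rule twin_free_path_forest) auto
  then show "\<not> full_colourable (path_forest ?ls) (cycle n)"
    by (rule path_forest_not_colourable[OF assms(1)]) (use w in auto)
  fix v assume v: "v \<in> verts (path_forest ?ls)"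
  obtain i j where ij: "v = (i, j)" by fastforce
  have i: "i < length ?ls" and j: "j < ?ls ! i" using v ij by auto
  then have l: "?ls ! i = 2" by simp
  show "full_colourable (induced (path_forest ?ls) (verts (path_forest ?ls) - {v})) (cycle n)"
    unfolding ij
    by (rule path_forest_fold[OF i, where l = 1 and h = "\<lambda>b. Some 0"])
      (use l w j in \<open>auto simp: less_Suc_eq numeral_eq_Suc\<close>)
qed

lemma in_LF_min_obstruction:
  assumes "n \<ge> 5" "in_LF (n - 1) G"
  shows "min_obstruction G (cycle n)"
proof -
  have e: "n - 1 + 2 = n + 1" "n - 1 + 1 = n" using assms(1) by simp_all
  consider m2 where "3 * m2 = n + 1" "isomorphic G (path_forest (replicate m2 2))"
    | m2 m4 where "3 * m2 + 5 * m4 = n"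
        "isomorphic G (path_forest (1 # replicate m2 2 @ replicate m4 4))"
    | m2 m4 m6 where "3 * m2 + 5 * m4 + 7 * m6 = n - 1"
        "isomorphic G (path_forest (1 # replicate m2 2 @ replicate m4 4 @ replicate m6 6))"
    using assms(2) unfolding in_LF_def e by blast
  then show ?thesis
  proof cases
    case 1
    then show ?thesis
      using isomorphic_min_obstruction[OF 1(2) min_obstruction_twos[OF _ 1(1)]] assms(1) by simp
  next
    case 2
    have "min_obstruction (path_forest (1 # replicate m2 2 @ replicate m4 4)) (cycle n)"
      by (rule min_obstruction_with_one)
        (use assms(1) 2(1) in \<open>auto simp: sum_list_replicate split: if_splits\<close>)
    then show ?thesis using isomorphic_min_obstruction[OF 2(2)] by blast
  next
    case 3
    have "min_obstruction (path_forest (1 # replicate m2 2 @ replicate m4 4 @ replicate m6 6)) (cycle n)"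
      by (rule min_obstruction_with_one)
        (use assms(1) 3(1) in \<open>auto simp: sum_list_replicate split: if_splits\<close>)
    then show ?thesis using isomorphic_min_obstruction[OF 3(2)] by blast
  qed
qed

section \<open>Cycles and the graphs A, B, E\<close>

lemma cycle_min_obstruction:
  assumes "m \<ge> 3" "m \<noteq> 4" "m < n"
  shows "min_obstruction (cycle m) (cycle n)"
proof (rule min_obstructionI)
  show "\<not> full_colourable (cycle m) (cycle n)" using assms by (intro cycle_not_colourable) auto
  fix v assume "v \<in> verts (cycle m)"
  then have v: "v < m" by simp
  show "full_colourable (induced (cycle m) (verts (cycle m) - {v})) (cycle n)"
    \<comment> \<open>The map numbers the remaining path from the successor of \<open>v\<close>
      around to its predecessor.\<close>
    by (rule line_colouring[where f = "\<lambda>x. if v < x then x - Suc v else x + m - Suc v"])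
      (use v assms in \<open>auto simp: edges_cycle split: if_splits\<close>)
qed

section \<open>The graphs A, B, E and their thresholds\<close>

lemma verts_graph_of [simp]: "verts (graph_of k es) = {0..<k}"
  by (simp add: graph_of_def verts_def)

lemma edges_graph_of [simp]: "edges (graph_of k es) = set es \<union> (set es)\<inverse>"
  by (simp add: graph_of_def edges_def)

lemma lessThan_six: "{0..<6::nat} = {0, 1, 2, 3, 4, 5}"
  by auto

text \<open>Neighbours with different neighbourhoods need different images, but \<open>f v\<close>
  has at most two neighbours. In A, B and E the centre is 1, with neighbours 0, 2, 4.\<close>

lemma spider_not_colourable:
  assumes V: "{a, b, c} \<subseteq> verts G" and v: "v \<in> verts G"
    and e: "(v, a) \<in> edges G" "(v, b) \<in> edges G" "(v, c) \<in> edges G"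
    and sep: "\<exists>z\<in>verts G. ((a, z) \<in> edges G) \<noteq> ((b, z) \<in> edges G)"
      "\<exists>z\<in>verts G. ((a, z) \<in> edges G) \<noteq> ((c, z) \<in> edges G)"
      "\<exists>z\<in>verts G. ((b, z) \<in> edges G) \<noteq> ((c, z) \<in> edges G)"
  shows "\<not> full_colourable G (cycle n)"
proof
  assume "full_colourable G (cycle n)"
  then obtain f where f: "full_hom G (cycle n) f" unfolding full_colourable_def by blast
  have "(f v, f a) \<in> edges (cycle n)" "(f v, f b) \<in> edges (cycle n)" "(f v, f c) \<in> edges (cycle n)"
    using full_hom_edge[OF f v] V e by auto
  then have "f a = f b \<or> f a = f c \<or> f b = f c" by (rule cycle_nbrs_at_most_two)
  moreover have "f x \<noteq> f y" if "x \<in> verts G" "y \<in> verts G"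
    "\<exists>z\<in>verts G. ((x, z) \<in> edges G) \<noteq> ((y, z) \<in> edges G)" for x y
    using full_hom_edge[OF f] that by metis
  ultimately show False using V sep by simp
qed

lemma verts_graphA: "verts graphA = {0..<6}"
  by (simp add: graphA_def)

lemma graphA_not_colourable: "\<not> full_colourable graphA (cycle n)"
  unfolding graphA_def
  by (rule spider_not_colourable[where v = 1 and a = 0 and b = 2 and c = 4]) (auto simp: lessThan_six)

lemma verts_graphB: "verts graphB = {0..<6}"
  by (simp add: graphB_def)

lemma graphB_not_colourable: "\<not> full_colourable graphB (cycle n)"
  unfolding graphB_def
  by (rule spider_not_colourable[where v = 1 and a = 0 and b = 2 and c = 4]) (auto simp: lessThan_six)

lemma verts_graphE: "verts graphE = {0..<6}"
  by (simp add: graphE_def)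

lemma graphE_not_colourable: "\<not> full_colourable graphE (cycle n)"
  unfolding graphE_def
  by (rule spider_not_colourable[where v = 1 and a = 0 and b = 2 and c = 4]) (auto simp: lessThan_six)

text \<open>\<open>cs\<close> is a table of colours 0 to \<open>k\<close>; vertex
  \<open>n - 1\<close> stays free, whence \<open>k + 2\<close>. The values 5, 4, 6 used below give
  the thresholds 7, 6, 8.\<close>

lemma list_colouring:
  assumes "\<forall>x\<in>S. cs ! x \<le> k" "k + 2 \<le> n"
    and "\<forall>x\<in>S. \<forall>y\<in>S. (x, y) \<in> edges G \<longleftrightarrow> cs ! y = Suc (cs ! x) \<or> cs ! x = Suc (cs ! y)"
  shows "full_colourable (induced G S) (cycle n)"
proof (rule line_colouring[where f = "(!) cs"])
  fix x assume "x \<in> verts (induced G S)"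
  then have "cs ! x \<le> k" using assms(1) by simp
  then show "cs ! x + 1 < n" using assms(2) by simp
qed (use assms(3) in auto)

text \<open>In the colour lists below, the entry 9 stands at the deleted vertex and is never looked up.\<close>

lemma graphA_min_obstruction:
  assumes "n \<ge> 7"
  shows "min_obstruction graphA (cycle n)"
proof (rule min_obstructionI[OF graphA_not_colourable])
  fix v assume "v \<in> verts graphA"
  then have "v \<in> {0, 1, 2, 3, 4, 5}" by (auto simp: graphA_def)
  then have "\<exists>cs. (\<forall>x\<in>{0..<6} - {v}. cs ! x \<le> 5) \<and>
    (\<forall>x\<in>{0..<6} - {v}. \<forall>y\<in>{0..<6} - {v}.
       (x, y) \<in> edges graphA \<longleftrightarrow> cs ! y = Suc (cs ! x) \<or> cs ! x = Suc (cs ! y))"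
    unfolding graphA_def lessThan_six
    apply (elim insertE emptyE)
         apply (rule exI[of _ "[9, 1, 0, 1, 2, 3]"], simp add: insert_Diff_if)
        apply (rule exI[of _ "[5, 9, 0, 1, 2, 3]"], simp add: insert_Diff_if)
       apply (rule exI[of _ "[0, 1, 9, 3, 2, 3]"], simp add: insert_Diff_if)
      apply (rule exI[of _ "[3, 2, 3, 9, 1, 0]"], simp add: insert_Diff_if)
     apply (rule exI[of _ "[3, 2, 1, 0, 9, 5]"], simp add: insert_Diff_if)
    apply (rule exI[of _ "[3, 2, 1, 0, 1, 9]"], simp add: insert_Diff_if)
    done
  then obtain cs where "\<forall>x\<in>{0..<6} - {v}. cs ! x \<le> 5"
    "\<forall>x\<in>{0..<6} - {v}. \<forall>y\<in>{0..<6} - {v}.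
       (x, y) \<in> edges graphA \<longleftrightarrow> cs ! y = Suc (cs ! x) \<or> cs ! x = Suc (cs ! y)"
    by blast
  then show "full_colourable (induced graphA (verts graphA - {v})) (cycle n)"
    using assms list_colouring[of "{0..<6} - {v}" cs 5 n graphA] by (simp add: verts_graphA)
qed

lemma graphB_min_obstruction:
  assumes "n \<ge> 6"
  shows "min_obstruction graphB (cycle n)"
proof (rule min_obstructionI[OF graphB_not_colourable])
  fix v assume "v \<in> verts graphB"
  then have "v \<in> {0, 1, 2, 3, 4, 5}" by (auto simp: graphB_def)
  then have "\<exists>cs. (\<forall>x\<in>{0..<6} - {v}. cs ! x \<le> 4) \<and>
    (\<forall>x\<in>{0..<6} - {v}. \<forall>y\<in>{0..<6} - {v}.
       (x, y) \<in> edges graphB \<longleftrightarrow> cs ! y = Suc (cs ! x) \<or> cs ! x = Suc (cs ! y))"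
    unfolding graphB_def lessThan_six
    apply (elim insertE emptyE)
         apply (rule exI[of _ "[9, 1, 0, 1, 2, 3]"], simp add: insert_Diff_if)
        apply (rule exI[of _ "[4, 9, 0, 1, 2, 3]"], simp add: insert_Diff_if)
       apply (rule exI[of _ "[0, 1, 9, 3, 2, 1]"], simp add: insert_Diff_if)
      apply (rule exI[of _ "[1, 2, 3, 9, 1, 0]"], simp add: insert_Diff_if)
     apply (rule exI[of _ "[3, 2, 1, 0, 9, 4]"], simp add: insert_Diff_if)
    apply (rule exI[of _ "[3, 2, 1, 0, 1, 9]"], simp add: insert_Diff_if)
    done
  then obtain cs where "\<forall>x\<in>{0..<6} - {v}. cs ! x \<le> 4"
    "\<forall>x\<in>{0..<6} - {v}. \<forall>y\<in>{0..<6} - {v}.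
       (x, y) \<in> edges graphB \<longleftrightarrow> cs ! y = Suc (cs ! x) \<or> cs ! x = Suc (cs ! y)"
    by blast
  then show "full_colourable (induced graphB (verts graphB - {v})) (cycle n)"
    using assms list_colouring[of "{0..<6} - {v}" cs 4 n graphB] by (simp add: verts_graphB)
qed

lemma graphE_min_obstruction:
  assumes "n \<ge> 8"
  shows "min_obstruction graphE (cycle n)"
proof (rule min_obstructionI[OF graphE_not_colourable])
  fix v assume "v \<in> verts graphE"
  then have "v \<in> {0, 1, 2, 3, 4, 5}" by (auto simp: graphE_def)
  then have "\<exists>cs. (\<forall>x\<in>{0..<6} - {v}. cs ! x \<le> 6) \<and>
    (\<forall>x\<in>{0..<6} - {v}. \<forall>y\<in>{0..<6} - {v}.
       (x, y) \<in> edges graphE \<longleftrightarrow> cs ! y = Suc (cs ! x) \<or> cs ! x = Suc (cs ! y))"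
    unfolding graphE_def lessThan_six
    apply (elim insertE emptyE)
         apply (rule exI[of _ "[9, 1, 2, 3, 0, 5]"], simp add: insert_Diff_if)
        apply (rule exI[of _ "[0, 9, 3, 4, 6, 1]"], simp add: insert_Diff_if)
       apply (rule exI[of _ "[2, 1, 9, 5, 0, 3]"], simp add: insert_Diff_if)
      apply (rule exI[of _ "[2, 1, 0, 9, 0, 3]"], simp add: insert_Diff_if)
     apply (rule exI[of _ "[3, 2, 1, 0, 9, 4]"], simp add: insert_Diff_if)
    apply (rule exI[of _ "[0, 1, 2, 3, 0, 9]"], simp add: insert_Diff_if)
    done
  then obtain cs where "\<forall>x\<in>{0..<6} - {v}. cs ! x \<le> 6"
    "\<forall>x\<in>{0..<6} - {v}. \<forall>y\<in>{0..<6} - {v}.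
       (x, y) \<in> edges graphE \<longleftrightarrow> cs ! y = Suc (cs ! x) \<or> cs ! x = Suc (cs ! y)"
    by blast
  then show "full_colourable (induced graphE (verts graphE - {v})) (cycle n)"
    using assms list_colouring[of "{0..<6} - {v}" cs 6 n graphE] by (simp add: verts_graphE)
qed

text \<open>This turns minimality into a lower bound on n: a twin-free proper induced subgraph
  embeds in the cycle, so it obeys the counting inequality.\<close>

lemma min_obstruction_card_bound:
  assumes "min_obstruction G (cycle n)" "wf_graph G" "S \<subset> verts G" "n \<ge> 3"
    and "twin_free (induced G S)"
  shows "4 * card S \<le> card (edges G \<inter> S \<times> S) + 2 * n"
proof -
  have "full_colourable (induced G S) (cycle n)"
    using assms(1,3) unfolding min_obstruction_def by blast
  moreover have "wf_graph (induced G S)" using assms(2,3) by (intro wf_graph_induced) auto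
  ultimately show ?thesis
    using not_colourable_of_card[of "induced G S" n] assms(4,5) by (force simp: edges_induced_eq)
qed

lemma wf_graph_of:
  assumes "\<And>x y. (x, y) \<in> set es \<Longrightarrow> x < k \<and> y < k \<and> x \<noteq> y"
  shows "wf_graph (graph_of k es)"
  using assms by (auto simp: wf_graph_def sym_def irrefl_def)

text \<open>Without vertex 1 the graph is K_1 + P_4, of width 7.\<close>

lemma graphA_bound:
  assumes "min_obstruction graphA (cycle n)" "n \<ge> 3"
  shows "n \<ge> 7"
proof -
  have "4 * card {0, 2, 3, 4, 5::nat} \<le>
      card (edges graphA \<inter> {0, 2, 3, 4, 5} \<times> {0, 2, 3, 4, 5}) + 2 * n"
  proof (rule min_obstruction_card_bound[OF assms(1) _ _ assms(2)])
    show "wf_graph graphA" unfolding graphA_def by (rule wf_graph_of) auto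
    show "twin_free (induced graphA {0, 2, 3, 4, 5})" by (auto simp: twin_free_def graphA_def)
  qed (auto simp: graphA_def)
  moreover have "edges graphA \<inter> {0, 2, 3, 4, 5} \<times> {0, 2, 3, 4, 5} =
      {(2, 3), (3, 4), (4, 5), (3, 2), (4, 3), (5, 4)}"
    by (auto simp: graphA_def)
  ultimately show ?thesis by simp
qed

text \<open>Without vertex 1 the graph is the path 2, 3, 4, 5, 0, of width 6.\<close>

lemma graphB_bound:
  assumes "min_obstruction graphB (cycle n)" "n \<ge> 3"
  shows "n \<ge> 6"
proof -
  have "4 * card {0, 2, 3, 4, 5::nat} \<le>
      card (edges graphB \<inter> {0, 2, 3, 4, 5} \<times> {0, 2, 3, 4, 5}) + 2 * n"
  proof (rule min_obstruction_card_bound[OF assms(1) _ _ assms(2)])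
    show "wf_graph graphB" unfolding graphB_def by (rule wf_graph_of) auto
    show "twin_free (induced graphB {0, 2, 3, 4, 5})" by (auto simp: twin_free_def graphB_def)
  qed (auto simp: graphB_def)
  moreover have "edges graphB \<inter> {0, 2, 3, 4, 5} \<times> {0, 2, 3, 4, 5} =
      {(2, 3), (3, 4), (4, 5), (3, 2), (4, 3), (5, 4), (0, 5), (5, 0)}"
    by (auto simp: graphB_def)
  ultimately show ?thesis by simp
qed

text \<open>Without vertex 1 the graph is K_1 + 2K_2, of width 8.\<close>

lemma graphE_bound:
  assumes "min_obstruction graphE (cycle n)" "n \<ge> 3"
  shows "n \<ge> 8"
proof -
  have "4 * card {0, 2, 3, 4, 5::nat} \<le>
      card (edges graphE \<inter> {0, 2, 3, 4, 5} \<times> {0, 2, 3, 4, 5}) + 2 * n"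
  proof (rule min_obstruction_card_bound[OF assms(1) _ _ assms(2)])
    show "wf_graph graphE" unfolding graphE_def by (rule wf_graph_of) auto
    show "twin_free (induced graphE {0, 2, 3, 4, 5})" by (auto simp: twin_free_def graphE_def)
  qed (auto simp: graphE_def)
  moreover have "edges graphE \<inter> {0, 2, 3, 4, 5} \<times> {0, 2, 3, 4, 5} =
      {(2, 3), (3, 2), (0, 5), (5, 0)}"
    by (auto simp: graphE_def)
  ultimately show ?thesis by simp
qed

section \<open>Graphs of maximum degree two\<close>

definition path_in :: "'a graph \<Rightarrow> 'a list \<Rightarrow> bool" where
  "path_in G p \<longleftrightarrow> p \<noteq> [] \<and> distinct p \<and> set p \<subseteq> verts G \<and>
     (\<forall>i. Suc i < length p \<longrightarrow> (p ! i, p ! Suc i) \<in> edges G)"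

text \<open>Chords are allowed; \<open>max_degree_two\<close> excludes them later. The length bound
  keeps a single edge from counting as closed.\<close>

definition cycle_in :: "'a graph \<Rightarrow> 'a list \<Rightarrow> bool" where
  "cycle_in G p \<longleftrightarrow> path_in G p \<and> length p \<ge> 3 \<and> (last p, hd p) \<in> edges G"

definition max_degree_two :: "'a graph \<Rightarrow> bool" where
  "max_degree_two G \<longleftrightarrow> (\<forall>v x y z. (v, x) \<in> edges G \<longrightarrow> (v, y) \<in> edges G \<longrightarrow> (v, z) \<in> edges G \<longrightarrow>
     x = y \<or> x = z \<or> y = z)"

lemma max_degree_twoD:
  "max_degree_two G \<Longrightarrow> (v, x) \<in> edges G \<Longrightarrow> (v, y) \<in> edges G \<Longrightarrow> (v, z) \<in> edges G \<Longrightarrow>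
     x = y \<or> x = z \<or> y = z"
  unfolding max_degree_two_def by blast

lemma path_in_nth_eq: "path_in G p \<Longrightarrow> i < length p \<Longrightarrow> j < length p \<Longrightarrow> p ! i = p ! j \<longleftrightarrow> i = j"
  by (simp add: path_in_def nth_eq_iff_index_eq)

lemma path_in_Cons:
  assumes "path_in G p" "(y, p ! 0) \<in> edges G" "y \<in> verts G" "y \<notin> set p"
  shows "path_in G (y # p)"
  using assms unfolding path_in_def by (auto simp: nth_Cons split: nat.splits)

lemma path_in_snoc:
  assumes "path_in G p" "(p ! (length p - 1), y) \<in> edges G" "y \<in> verts G" "y \<notin> set p"
  shows "path_in G (p @ [y])"
proof -
  have "((p @ [y]) ! i, (p @ [y]) ! Suc i) \<in> edges G" if "Suc i < length (p @ [y])" for i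
  proof (cases "Suc i < length p")
    case True
    then show ?thesis using assms(1) by (auto simp: path_in_def nth_append)
  next
    case False
    then have "i = length p - 1" "Suc i = length p" using that by auto
    then show ?thesis using assms(2) by (simp add: nth_append)
  qed
  then show ?thesis using assms unfolding path_in_def by auto
qed

text \<open>A longest path is an induced component: inner vertices already have two neighbours on
  it, an edge leaving an end would lengthen it, and an edge joining its ends would close a
  cycle.\<close>

lemma max_path_nbrs:
  assumes wf: "wf_graph G" and deg: "max_degree_two G" and acyc: "\<And>p. \<not> cycle_in G p"
    and p: "path_in G p" and mx: "\<And>q. path_in G q \<Longrightarrow> length q \<le> length p"
    and i: "i < length p" and e: "(p ! i, y) \<in> edges G"
  shows "\<exists>k<length p. y = p ! k \<and> (k = Suc i \<or> i = Suc k)"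
proof -
  have sym: "(b, a) \<in> edges G" if "(a, b) \<in> edges G" for a b using wf_graph_sym[OF wf that] .
  have yV: "y \<in> verts G" using wf_graph_verts[OF wf e] by simp
  have up: "(p ! j, p ! Suc j) \<in> edges G" if "Suc j < length p" for j
    using p that by (simp add: path_in_def)
  have inner: "y = p ! (j - 1) \<or> y = p ! Suc j"
    if "0 < j" "Suc j < length p" "(p ! j, y) \<in> edges G" for j y
  proof -
    have "(p ! j, p ! (j - 1)) \<in> edges G" using sym up[of "j - 1"] that by simp
    moreover have "p ! (j - 1) \<noteq> p ! Suc j" using path_in_nth_eq[OF p] that by simp
    ultimately show ?thesis using max_degree_twoD[OF deg _ up[OF that(2)] that(3)] by metis
  qed
  show ?thesis
  proof (cases "0 < i \<and> Suc i < length p")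
    case True
    then have "y = p ! (i - 1) \<or> y = p ! Suc i" using inner e by blast
    then show ?thesis
      using True by (auto intro: exI[of _ "i - 1"] exI[of _ "Suc i"])
  next
    case False
    have "y \<in> set p"
    proof (rule ccontr)
      assume y: "y \<notin> set p"
      have "i = 0 \<or> i = length p - 1" using False i by auto
      then have "path_in G (y # p) \<or> path_in G (p @ [y])"
        using path_in_Cons[OF p _ yV y] path_in_snoc[OF p _ yV y] e sym by blast
      then show False using mx[of "y # p"] mx[of "p @ [y]"] by auto
    qed
    then obtain k where k: "k < length p" "y = p ! k" by (auto simp: in_set_conv_nth)
    have "k \<noteq> i" using e k wf_graph_irrefl[OF wf] by auto
    show ?thesis
    proof (cases "0 < k \<and> Suc k < length p")
      case True
      then have "p ! i = p ! (k - 1) \<or> p ! i = p ! Suc k" using inner sym e k by blast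
      then have "k = Suc i \<or> i = Suc k" using path_in_nth_eq[OF p] i k True by auto
      then show ?thesis using k by blast
    next
      case F2: False
      then have ik: "i = 0 \<and> k = length p - 1 \<or> k = 0 \<and> i = length p - 1"
        using False \<open>k \<noteq> i\<close> i k by auto
      \<comment> \<open>Both vertices are ends: without a cycle the path has only two vertices, and
        these are consecutive.\<close>
      then have "(p ! (length p - 1), p ! 0) \<in> edges G" using e sym k by blast
      then have "(last p, hd p) \<in> edges G" using p by (simp add: path_in_def last_conv_nth hd_conv_nth)
      then have "length p < 3" using acyc p unfolding cycle_in_def by (meson not_le)
      then have "k = Suc i \<or> i = Suc k" using ik \<open>k \<noteq> i\<close> i k by auto
      then show ?thesis using k by blast
    qed
  qed
qed

text \<open>By \<open>nbrs\<close> the path has no chords and no edges to the rest, so it can be put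
  in front as path 0, shifting the other indices by one.\<close>

lemma path_forest_Cons_iso:
  assumes wf: "wf_graph G" and p: "path_in G p"
    and nbrs: "\<And>i y. i < length p \<Longrightarrow> (p ! i, y) \<in> edges G \<Longrightarrow>
      \<exists>k<length p. y = p ! k \<and> (k = Suc i \<or> i = Suc k)"
    and iso: "isomorphic (induced G (verts G - set p)) (path_forest ls)"
  shows "isomorphic G (path_forest (length p # ls))"
proof -
  let ?H = "induced G (verts G - set p)"
  obtain g where g: "bij_betw g (verts (path_forest ls)) (verts ?H)" "full_hom (path_forest ls) ?H g"
    using isomorphic_sym[OF iso] isomorphic_full_hom by blast
  define h where "h = (\<lambda>(a, b). if a = 0 then p ! b else g (a - 1, b))"
  let ?P = "path_forest (length p # ls)"
  have sym: "(b, a) \<in> edges G" if "(a, b) \<in> edges G" for a b using wf_graph_sym[OF wf that] .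
  have pe: "(p ! i, p ! j) \<in> edges G \<longleftrightarrow> j = Suc i \<or> i = Suc j"
    if "i < length p" "j < length p" for i j
    using nbrs[OF that(1), of "p ! j"] that p path_in_nth_eq[OF p] sym unfolding path_in_def by metis
  have gV: "g (a, b) \<in> verts G \<and> g (a, b) \<notin> set p" if "a < length ls" "b < ls ! a" for a b
    using full_hom_verts[OF g(2), of "(a, b)"] that by simp
  have cross: "(p ! b, g (a', b')) \<notin> edges G \<and> (g (a', b'), p ! b) \<notin> edges G"
    if "b < length p" "a' < length ls" "b' < ls ! a'" for b a' b'
  proof -
    have "(p ! b, g (a', b')) \<notin> edges G"
      using nbrs[OF that(1), of "g (a', b')"] gV[OF that(2,3)] by (metis nth_mem)
    then show ?thesis using sym by blast
  qed
  have ge: "(g (a, b), g (a', b')) \<in> edges G \<longleftrightarrow> ((a, b), (a', b')) \<in> edges (path_forest ls)"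
    if "a < length ls" "b < ls ! a" "a' < length ls" "b' < ls ! a'" for a b a' b'
    using full_hom_edge[OF g(2), of "(a, b)" "(a', b')"] that gV[OF that(1,2)] gV[OF that(3,4)] by auto
  have inj_g: "g (a, b) = g (a', b') \<Longrightarrow> a = a' \<and> b = b'"
    if "a < length ls" "b < ls ! a" "a' < length ls" "b' < ls ! a'" for a b a' b'
    using g(1) that unfolding bij_betw_def inj_on_def
    by (metis Pair_inject verts_path_forest)
  have hedge: "(x, y) \<in> edges ?P \<longleftrightarrow> (h x, h y) \<in> edges G" if "x \<in> verts ?P" "y \<in> verts ?P" for x y
  proof -
    obtain a b a' b' where xy: "x = (a, b)" "y = (a', b')" by (metis surj_pair)
    then show ?thesis
      using that pe[of b b'] cross[of b "a' - 1" b'] cross[of b' "a - 1" b] ge[of "a - 1" b "a' - 1" b']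
      by (cases a; cases a') (auto simp: h_def)
  qed
  have "inj_on h (verts ?P)"
  proof (rule inj_onI)
    fix x y assume xy: "x \<in> verts ?P" "y \<in> verts ?P" "h x = h y"
    obtain a b a' b' where ab: "x = (a, b)" "y = (a', b')" by (metis surj_pair)
    show "x = y"
    proof (cases a; cases a')
      assume "a = 0" "a' = 0"
      then show ?thesis using xy ab path_in_nth_eq[OF p, of b b'] by (auto simp: h_def)
    next
      fix c' assume "a = 0" "a' = Suc c'"
      then show ?thesis using xy ab gV[of c' b'] nth_mem[of b p] by (auto simp: h_def)
    next
      fix c assume "a = Suc c" "a' = 0"
      then show ?thesis using xy ab gV[of c b] nth_mem[of b' p] by (auto simp: h_def)
    next
      fix c c' assume "a = Suc c" "a' = Suc c'"
      then show ?thesis using xy ab inj_g[of c b c' b'] by (auto simp: h_def)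
    qed
  qed
  moreover have "h ` verts ?P = verts G"
  proof
    have "h x \<in> verts G" if "x \<in> verts ?P" for x
    proof -
      obtain a b where ab: "x = (a, b)" by fastforce
      have "set p \<subseteq> verts G" using p by (simp add: path_in_def)
      then show ?thesis using that ab gV[of "a - 1" b] nth_mem[of b p] by (cases a) (auto simp: h_def)
    qed
    then show "h ` verts ?P \<subseteq> verts G" by blast
    show "verts G \<subseteq> h ` verts ?P"
    proof
      fix x assume x: "x \<in> verts G"
      show "x \<in> h ` verts ?P"
      proof (cases "x \<in> set p")
        case True
        then obtain b where "b < length p" "x = p ! b" by (auto simp: in_set_conv_nth)
        then have "(0, b) \<in> verts ?P" "x = h (0, b)" by (auto simp: h_def)
        then show ?thesis by blast
      next
        case False
        then have "x \<in> g ` verts (path_forest ls)" using g(1) x by (simp add: bij_betw_def)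
        then obtain a b where "(a, b) \<in> verts (path_forest ls)" "x = g (a, b)" by fastforce
        then have "(Suc a, b) \<in> verts ?P" "x = h (Suc a, b)" by (auto simp: h_def)
        then show ?thesis by blast
      qed
    qed
  qed
  ultimately have "bij_betw h (verts ?P) (verts G)" by (simp add: bij_betw_def)
  then have "isomorphic ?P G" using hedge unfolding isomorphic_def by blast
  then show ?thesis by (rule isomorphic_sym)
qed

text \<open>Induction on the number of vertices: a longest path is a component and is split
  off.\<close>

lemma linear_forest_iso:
  assumes "wf_graph G" "max_degree_two G" "\<And>p. \<not> cycle_in G p"
  shows "\<exists>ls. 0 \<notin> set ls \<and> isomorphic G (path_forest ls)"
  using assms
proof (induction "card (verts G)" arbitrary: G rule: less_induct)
  case less
  note wf = less.prems(1) and deg = less.prems(2) and acyc = less.prems(3)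
  have fin: "finite (verts G)" using wf by (simp add: wf_graph_def)
  show ?case
  proof (cases "verts G = {}")
    case True
    then have "isomorphic G (path_forest [])"
      by (auto simp: isomorphic_def verts_path_forest_Sigma bij_betw_def)
    then show ?thesis by (intro exI[of _ "[]"]) simp
  next
    case False
    then obtain v where v: "v \<in> verts G" by blast
    have "path_in G [v]" using v by (simp add: path_in_def)
    moreover have "length p < Suc (card (verts G))" if "path_in G p" for p
      using that card_mono[OF fin, of "set p"] distinct_card[of p] unfolding path_in_def by simp
    ultimately obtain p where p: "path_in G p" and mx: "\<And>q. path_in G q \<Longrightarrow> length q \<le> length p"
      using ex_has_greatest_nat[of "path_in G" "[v]" length "Suc (card (verts G))"] by (metis less_imp_le)
    let ?H = "induced G (verts G - set p)"
    have "p \<noteq> []" "set p \<subseteq> verts G" using p by (simp_all add: path_in_def)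
    then have "p ! 0 \<in> verts G" "p ! 0 \<notin> verts ?H" by auto
    then have "verts ?H \<subset> verts G" by auto
    then have "card (verts ?H) < card (verts G)" by (rule psubset_card_mono[OF fin])
    moreover have "wf_graph ?H" by (rule wf_graph_induced[OF wf]) blast
    moreover have "max_degree_two ?H" using deg unfolding max_degree_two_def edges_induced by blast
    moreover have "\<not> cycle_in ?H q" for q
    proof
      assume "cycle_in ?H q"
      then have "cycle_in G q" unfolding cycle_in_def path_in_def by auto
      then show False using acyc by blast
    qed
    ultimately obtain ls where ls: "0 \<notin> set ls" "isomorphic ?H (path_forest ls)"
      using less.hyps[of ?H] by blast
    have "isomorphic G (path_forest (length p # ls))"
      by (rule path_forest_Cons_iso[OF wf p _ ls(2)])
        (rule max_path_nbrs[OF wf deg acyc p mx])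
    moreover have "0 \<notin> set (length p # ls)" using ls(1) p by (simp add: path_in_def)
    ultimately show ?thesis by blast
  qed
qed

text \<open>Each vertex of \<open>p\<close> has two neighbours along the cycle, which leaves no room
  for chords or for edges leaving it.\<close>

lemma max_degree_two_cycle:
  assumes wf: "wf_graph G" and deg: "max_degree_two G" and p: "cycle_in G p"
  shows "isomorphic (induced G (set p)) (cycle (length p))"
    and "x \<in> set p \<Longrightarrow> (x, y) \<in> edges G \<Longrightarrow> y \<in> set p"
    and "i < length p \<Longrightarrow> j < length p \<Longrightarrow> (p ! i, p ! j) \<in> edges G \<longleftrightarrow> (i, j) \<in> edges (cycle (length p))"
proof -
  let ?m = "length p"
  have pp: "path_in G p" and m: "?m \<ge> 3" and cl: "(last p, hd p) \<in> edges G"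
    using p by (auto simp: cycle_in_def)
  have sym: "(b, a) \<in> edges G" if "(a, b) \<in> edges G" for a b using wf_graph_sym[OF wf that] .
  have cl': "(p ! (?m - 1), p ! 0) \<in> edges G"
    using cl pp by (simp add: path_in_def last_conv_nth hd_conv_nth)
  have up: "(p ! j, p ! Suc j) \<in> edges G" if "Suc j < length p" for j
    using pp that by (simp add: path_in_def)
  have bwd: "(p ! i, p ! j) \<in> edges G" if ij: "(i, j) \<in> edges (cycle ?m)" for i j
  proof -
    have lt: "i < ?m" "j < ?m" using ij by (auto simp: edges_cycle)
    consider "j = Suc i" | "i = Suc j" | "i = 0" "j = ?m - 1" | "j = 0" "i = ?m - 1"
      using ij by (auto simp: edges_cycle)
    then show ?thesis using lt up sym cl' by cases auto
  qed
  have fwd: "\<exists>j. (i, j) \<in> edges (cycle ?m) \<and> y = p ! j"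
    if i: "i < ?m" and y: "(p ! i, y) \<in> edges G" for i y
  proof -
    obtain j k where jk: "j \<noteq> k" "(i, j) \<in> edges (cycle ?m)" "(i, k) \<in> edges (cycle ?m)"
      using cycle_two_nbrs m i by metis
    then have "p ! j \<noteq> p ! k" using path_in_nth_eq[OF pp] by (auto simp: edges_cycle)
    then have "y = p ! j \<or> y = p ! k"
      using max_degree_twoD[OF deg bwd[OF jk(2)] bwd[OF jk(3)] y] by auto
    then show ?thesis using jk by blast
  qed
  show "y \<in> set p" if x: "x \<in> set p" and xy: "(x, y) \<in> edges G"
  proof -
    obtain i where i: "i < ?m" "x = p ! i" using x by (metis in_set_conv_nth)
    then obtain j where "(i, j) \<in> edges (cycle ?m)" "y = p ! j" using fwd xy by blast
    then show ?thesis by (auto simp: edges_cycle)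
  qed
  show adj: "(p ! i, p ! j) \<in> edges G \<longleftrightarrow> (i, j) \<in> edges (cycle ?m)"
    if ij: "i < ?m" "j < ?m" for i j
  proof
    assume "(p ! i, p ! j) \<in> edges G"
    then obtain k where k: "(i, k) \<in> edges (cycle ?m)" "p ! j = p ! k" using fwd ij by blast
    then have "k < ?m" by (auto simp: edges_cycle)
    then show "(i, j) \<in> edges (cycle ?m)" using k path_in_nth_eq[OF pp ij(2)] by simp
  qed (rule bwd)
  show "isomorphic (induced G (set p)) (cycle ?m)"
    by (rule isomorphic_of_list[of p]) (use adj pp in \<open>auto simp: path_in_def\<close>)
qed

section \<open>Classification\<close>

definition triangle_free :: "'a graph \<Rightarrow> bool" where
  "triangle_free G \<longleftrightarrow> (\<forall>x y z. (x, y) \<in> edges G \<longrightarrow> (y, z) \<in> edges G \<longrightarrow> (x, z) \<notin> edges G)"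

text \<open>The alternatives \<open>a = c\<close> and \<open>b = d\<close> exempt closed walks that
  retrace an edge.\<close>

definition square_free :: "'a graph \<Rightarrow> bool" where
  "square_free G \<longleftrightarrow> (\<forall>a b c d. (a, b) \<in> edges G \<longrightarrow> (b, c) \<in> edges G \<longrightarrow> (c, d) \<in> edges G \<longrightarrow>
     (d, a) \<in> edges G \<longrightarrow> a = c \<or> b = d)"

text \<open>Distinctness is not demanded: in a loopless triangle-free graph every closed walk of
  length five is a 5-cycle.\<close>

definition pentagon_free :: "'a graph \<Rightarrow> bool" where
  "pentagon_free G \<longleftrightarrow> (\<forall>a b c d e. (a, b) \<in> edges G \<longrightarrow> (b, c) \<in> edges G \<longrightarrow> (c, d) \<in> edges G \<longrightarrow>
     (d, e) \<in> edges G \<longrightarrow> (e, a) \<notin> edges G)"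

lemma induced_verts: "wf_graph G \<Longrightarrow> induced G (verts G) = G"
  unfolding wf_graph_def induced_def verts_def edges_def by (rule prod_eqI) auto

text \<open>How G is identified in every case below: by minimality, a non-colourable induced
  subgraph is all of G.\<close>

lemma min_obstruction_isoI:
  assumes "min_obstruction G K" "wf_graph G" "S \<subseteq> verts G"
    and "isomorphic (induced G S) H" "\<not> full_colourable H K"
  shows "isomorphic G H"
proof -
  have "\<not> full_colourable (induced G S) K"
    using isomorphic_colourable[OF isomorphic_sym[OF assms(4)]] assms(5) by blast
  then have "verts G = S" using min_obstruction_verts[OF assms(1,3)] by blast
  then show ?thesis using induced_verts[OF assms(2)] assms(4) by metis
qed

text \<open>The cycle without vertex 0 is a path on m - 1 vertices, at least four, hence not P_3. A
  possible twin lies at distance two, and a neighbour on the far side of one of the two separates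
  them.\<close>

lemma punctured_cycle_twin_free:
  assumes "m \<ge> 5" "1 \<le> x" "x < m" "1 \<le> y" "y < m"
    and tw: "\<And>z. 1 \<le> z \<Longrightarrow> z < m \<Longrightarrow> (x, z) \<in> edges (cycle m) \<longleftrightarrow> (y, z) \<in> edges (cycle m)"
  shows "x = y"
proof -
  have tw': "(z = Suc x \<or> x = Suc z) \<longleftrightarrow> (z = Suc y \<or> y = Suc z)" if "1 \<le> z" "z < m" for z
    using tw[OF that] that assms(2-5) by (auto simp: edges_cycle)
  have down: "y = x \<or> Suc (Suc y) = x" if "2 \<le> x"
    using tw'[of "x - 1"] that assms(3) by (cases x) auto
  have up: "y = x \<or> y = Suc (Suc x)" if "Suc x < m" using tw'[of "Suc x"] that by auto
  show ?thesis
  proof (cases "2 \<le> x \<and> Suc x < m")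
    case True
    then show ?thesis using down up by auto
  next
    case False
    then have "x = 1 \<or> Suc x = m" using assms(2,3) by auto
    then show ?thesis
    proof
      assume "x = 1"
      then have "y = 1 \<or> y = 3" using up assms(1) by auto
      then show ?thesis using tw'[of 4] \<open>x = 1\<close> assms(1) by auto
    next
      assume "Suc x = m"
      then have "y = x \<or> Suc (Suc y) = x" using down assms(1) by auto
      then show ?thesis using tw'[of "y - 1"] \<open>Suc x = m\<close> assms(1) by (cases y) auto
    qed
  qed
qed

lemma min_obstruction_list:
  assumes "min_obstruction G K" "wf_graph G" "set vs \<subseteq> verts G" "distinct vs"
    and "verts H = {0..<length vs}"
    and "\<forall>i<length vs. \<forall>j<length vs. (vs ! i, vs ! j) \<in> edges G \<longleftrightarrow> (i, j) \<in> edges H"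
    and "\<not> full_colourable H K"
  shows "isomorphic G H"
proof (rule min_obstruction_isoI[OF assms(1-3) _ assms(7)])
  show "isomorphic (induced G (set vs)) H"
    by (rule isomorphic_of_list[of vs]) (use assms in auto)
qed

context
  fixes G :: "'a graph" and n :: nat
  assumes n: "n \<ge> 5" and wf: "wf_graph G" and obs: "min_obstruction G (cycle n)"
begin

lemma edge_commute: "(x, y) \<in> edges G \<longleftrightarrow> (y, x) \<in> edges G"
  using wf_graph_sym[OF wf] by blast

lemma no_loop: "(x, x) \<notin> edges G"
  using wf_graph_irrefl[OF wf] .

lemma edge_verts: "(x, y) \<in> edges G \<Longrightarrow> x \<in> verts G \<and> y \<in> verts G"
  using wf_graph_verts[OF wf] .

lemma separated:
  assumes "x \<in> verts G" "y \<in> verts G" "x \<noteq> y"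
  obtains z where "(x, z) \<in> edges G" "(y, z) \<notin> edges G" | z where "(y, z) \<in> edges G" "(x, z) \<notin> edges G"
proof -
  have "twin_free G" by (rule min_obstruction_twin_free[OF wf obs cycle_irrefl]) (use n in simp)
  then show ?thesis using assms that unfolding twin_free_def by metis
qed

section \<open>Obstructions that are not linear forests\<close>

lemma triangle_case:
  assumes "(x, y) \<in> edges G" "(y, z) \<in> edges G" "(x, z) \<in> edges G"
  shows "in_C (n - 2) G"
proof -
  have "isomorphic G (cycle 3)"
  proof (rule min_obstruction_list[OF obs wf, of "[x, y, z]"])
    show "\<not> full_colourable (cycle 3) (cycle n)" using n by (intro cycle_not_colourable) auto
    show "set [x, y, z] \<subseteq> verts G" "distinct [x, y, z]"
      using assms edge_verts no_loop by auto
    show "\<forall>i<length [x, y, z]. \<forall>j<length [x, y, z].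
      (([x, y, z] ! i, [x, y, z] ! j) \<in> edges G) = ((i, j) \<in> edges (cycle 3))"
      using assms edge_commute no_loop by (simp add: All_less_Suc edges_cycle)
  qed (simp add: numeral_eq_Suc)
  then show ?thesis unfolding in_C_def by blast
qed

context
  assumes tf: "triangle_free G"
begin

lemma no_triangle: "(x, y) \<in> edges G \<Longrightarrow> (y, z) \<in> edges G \<Longrightarrow> (x, z) \<notin> edges G"
  using tf unfolding triangle_free_def by blast

text \<open>\<open>x\<close> separates the opposite corners \<open>a\<close>, \<open>c\<close>, and
  \<open>y\<close> separates \<open>b\<close>, \<open>d\<close>. Excluding triangles settles all
  further adjacencies except that of \<open>x\<close> and \<open>y\<close>, which decides between A
  and B.\<close>

lemma square_case_aux:
  assumes e: "(a, b) \<in> edges G" "(b, c) \<in> edges G" "(c, d) \<in> edges G" "(d, a) \<in> edges G"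
    and x: "(x, a) \<in> edges G" "(x, c) \<notin> edges G" and y: "(y, b) \<in> edges G" "(y, d) \<notin> edges G"
  shows "in_O (n - 1) G"
proof -
  \<comment> \<open>In the order of the labels 0 to 5: the square is 1, 2, 3, 4, with pendant edges
    01 and 45.\<close>
  let ?vs = "[x, a, d, c, b, y]"
  note e' = e x(1) y(1) e[unfolded edge_commute[of a b] edge_commute[of b c] edge_commute[of c d] edge_commute[of d a]]
    x(1)[unfolded edge_commute[of x a]] y(1)[unfolded edge_commute[of y b]]
  have ne: "(a, c) \<notin> edges G" "(b, d) \<notin> edges G" "(x, b) \<notin> edges G" "(x, d) \<notin> edges G"
    "(y, a) \<notin> edges G" "(y, c) \<notin> edges G"
    using no_triangle e' by blast+
  have ne': "(c, a) \<notin> edges G" "(d, b) \<notin> edges G" "(b, x) \<notin> edges G" "(d, x) \<notin> edges G"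
    "(a, y) \<notin> edges G" "(c, y) \<notin> edges G" "(c, x) \<notin> edges G" "(d, y) \<notin> edges G"
    using ne x y edge_commute by blast+
  have dist: "distinct ?vs" using e' ne ne' x y no_loop by auto
  have V: "set ?vs \<subseteq> verts G" using e' edge_verts by auto
  show ?thesis
  proof (cases "(x, y) \<in> edges G")
    case True
    have "isomorphic G graphB"
    proof (rule min_obstruction_list[OF obs wf V dist _ _ graphB_not_colourable])
      show "\<forall>i<length ?vs. \<forall>j<length ?vs. ((?vs ! i, ?vs ! j) \<in> edges G) = ((i, j) \<in> edges graphB)"
        using e' ne ne' x y no_loop True True[unfolded edge_commute[of x y]] by (simp add: All_less_Suc graphB_def)
    qed (simp add: graphB_def numeral_eq_Suc)
    moreover have "n \<ge> 6"
      using graphB_bound isomorphic_min_obstruction[OF isomorphic_sym[OF calculation] obs] n by simp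
    ultimately show ?thesis unfolding in_O_def by auto
  next
    case False
    then have F: "(x, y) \<notin> edges G" "(y, x) \<notin> edges G" using edge_commute by blast+
    have "isomorphic G graphA"
    proof (rule min_obstruction_list[OF obs wf V dist _ _ graphA_not_colourable])
      show "\<forall>i<length ?vs. \<forall>j<length ?vs. ((?vs ! i, ?vs ! j) \<in> edges G) = ((i, j) \<in> edges graphA)"
        using e' ne ne' x y no_loop F by (simp add: All_less_Suc graphA_def)
    qed (simp add: graphA_def numeral_eq_Suc)
    moreover have "n \<ge> 7"
      using graphA_bound isomorphic_min_obstruction[OF isomorphic_sym[OF calculation] obs] n by simp
    ultimately show ?thesis unfolding in_O_def by auto
  qed
qed

lemma square_case:
  assumes e: "(a, b) \<in> edges G" "(b, c) \<in> edges G" "(c, d) \<in> edges G" "(d, a) \<in> edges G"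
    and "a \<noteq> c" "b \<noteq> d"
  shows "in_O (n - 1) G"
proof -
  have s: "(b, a) \<in> edges G" "(c, b) \<in> edges G" "(d, c) \<in> edges G" "(a, d) \<in> edges G"
    using e edge_commute by blast+
  have V: "a \<in> verts G" "b \<in> verts G" "c \<in> verts G" "d \<in> verts G" using e edge_verts by blast+
  obtain x where x: "(x, a) \<in> edges G \<and> (x, c) \<notin> edges G \<or> (x, c) \<in> edges G \<and> (x, a) \<notin> edges G"
    using separated[OF V(1,3) assms(5)] edge_commute by metis
  obtain y where y: "(y, b) \<in> edges G \<and> (y, d) \<notin> edges G \<or> (y, d) \<in> edges G \<and> (y, b) \<notin> edges G"
    using separated[OF V(2,4) assms(6)] edge_commute by metis
  show ?thesis
    \<comment> \<open>Four symmetric copies, according to which of \<open>a\<close>,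
      \<open>c\<close> and which of \<open>b\<close>, \<open>d\<close> has the private
      neighbour.\<close>
    using x y square_case_aux[of a b c d x y] square_case_aux[of c b a d x y]
      square_case_aux[of a d c b x y] square_case_aux[of c d a b x y] e s by blast
qed

context
  assumes sf: "square_free G"
begin

lemma no_square: "(a, b) \<in> edges G \<Longrightarrow> (b, c) \<in> edges G \<Longrightarrow> (c, d) \<in> edges G \<Longrightarrow> (d, a) \<in> edges G \<Longrightarrow>
    a = c \<or> b = d"
  using sf unfolding square_free_def by blast

text \<open>Replacing \<open>b\<close> in the 5-cycle by \<open>v\<close> yields a twin-free graph on five vertices in which
  \<open>v\<close> has degree at most one, so it is no \<open>C\<^sub>5\<close>.\<close>

lemma pentagon_plus_vertex:
  assumes "n = 5"
    and e: "(a, b) \<in> edges G" "(b, c) \<in> edges G" "(c, d) \<in> edges G" "(d, e) \<in> edges G" "(e, a) \<in> edges G"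
    and v: "v \<in> verts G" "v \<notin> {a, b, c, d, e}"
      "(v, b) \<notin> edges G" "(v, c) \<notin> edges G" "(v, d) \<notin> edges G" "(v, e) \<notin> edges G"
  shows False
proof -
  have s: "(b, a) \<in> edges G" "(c, b) \<in> edges G" "(d, c) \<in> edges G" "(e, d) \<in> edges G" "(a, e) \<in> edges G"
    "(c, v) \<notin> edges G" "(d, v) \<notin> edges G" "(e, v) \<notin> edges G"
    using e v edge_commute by blast+
  have ne: "(a, c) \<notin> edges G" "(a, d) \<notin> edges G" "(c, e) \<notin> edges G"
    using no_triangle e s by blast+
  have ne': "(c, a) \<notin> edges G" "(d, a) \<notin> edges G" "(e, c) \<notin> edges G"
    using ne edge_commute by blast+
  have dist: "distinct [a, c, d, e, b]"
    using e s ne ne' no_loop by auto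
  let ?S = "{v, a, c, d, e}"
  have "?S \<subseteq> verts G" "b \<in> verts G" using v(1) e edge_verts by auto
  moreover have "b \<notin> ?S" using v(2) dist by auto
  ultimately have "?S \<subset> verts G" by blast
  then have col: "full_colourable (induced G ?S) (cycle n)"
    using obs unfolding min_obstruction_def by blast
  have tf: "twin_free (induced G ?S)"
    unfolding twin_free_def
  proof (intro ballI impI)
    fix x y assume xy: "x \<in> verts (induced G ?S)" "y \<in> verts (induced G ?S)"
      and "\<forall>z\<in>verts (induced G ?S). ((x, z) \<in> edges (induced G ?S)) = ((y, z) \<in> edges (induced G ?S))"
    then have "(x, a) \<in> edges G \<longleftrightarrow> (y, a) \<in> edges G" "(x, c) \<in> edges G \<longleftrightarrow> (y, c) \<in> edges G"
      "(x, d) \<in> edges G \<longleftrightarrow> (y, d) \<in> edges G" "(x, e) \<in> edges G \<longleftrightarrow> (y, e) \<in> edges G"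
      by auto
    then show "x = y" using xy e s ne ne' v no_loop by (simp only: verts_induced) (elim insertE emptyE; simp)
  qed
  have "card ?S = n" using dist v \<open>n = 5\<close> by simp
  then obtain x y where "x \<noteq> y" "x \<in> ?S" "y \<in> ?S" "(v, x) \<in> edges G" "(v, y) \<in> edges G"
    using spanning_embedding_two_nbrs[OF col tf, of v] n by auto
  then show False using v no_loop by auto
qed

text \<open>For \<open>n \<noteq> 5\<close> the induced 5-cycle is not colourable and so is G. For
  \<open>n = 5\<close> it is colourable, so G has a further vertex; any two vertices of the pentagon
  have distance one or two, so excluding triangles and squares leaves that vertex at most one
  neighbour there.\<close>

lemma pentagon_case:
  assumes e: "(a, b) \<in> edges G" "(b, c) \<in> edges G" "(c, d) \<in> edges G" "(d, e) \<in> edges G" "(e, a) \<in> edges G"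
  shows "in_C (n - 2) G"
proof -
  let ?vs = "[a, b, c, d, e]"
  have s: "(b, a) \<in> edges G" "(c, b) \<in> edges G" "(d, c) \<in> edges G" "(e, d) \<in> edges G" "(a, e) \<in> edges G"
    using e edge_commute by blast+
  have ne: "(a, c) \<notin> edges G" "(a, d) \<notin> edges G" "(c, e) \<notin> edges G" "(b, d) \<notin> edges G" "(b, e) \<notin> edges G"
    using no_triangle e s by blast+
  have ne': "(c, a) \<notin> edges G" "(d, a) \<notin> edges G" "(e, c) \<notin> edges G" "(d, b) \<notin> edges G" "(e, b) \<notin> edges G"
    using ne edge_commute by blast+
  have dist: "distinct ?vs" using e s ne ne' no_loop by auto
  have V: "set ?vs \<subseteq> verts G" using e edge_verts by auto
  have adj: "\<forall>i<length ?vs. \<forall>j<length ?vs. ((?vs ! i, ?vs ! j) \<in> edges G) = ((i, j) \<in> edges (cycle 5))"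
    using e s ne ne' no_loop by (simp add: All_less_Suc edges_cycle)
  have c5: "verts (cycle 5) = {0..<length ?vs}" by (simp add: numeral_eq_Suc)
  show ?thesis
  proof (cases "n = 5")
    case False
    have "isomorphic G (cycle 5)"
    proof (rule min_obstruction_list[OF obs wf V dist c5 adj])
      show "\<not> full_colourable (cycle 5) (cycle n)" using False by (intro cycle_not_colourable) auto
    qed
    then show ?thesis using n False unfolding in_C_def by (intro exI[of _ 5]) auto
  next
    case True
    have "verts G \<noteq> set ?vs"
    proof
      assume "verts G = set ?vs"
      then have "isomorphic G (cycle 5)"
        using adj by (intro isomorphic_of_list[OF dist _ c5]) auto
      then have "full_colourable G (cycle n)"
        unfolding isomorphic_full_hom full_colourable_def True by blast
      then show False using obs unfolding min_obstruction_def by blast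
    qed
    then obtain v where v: "v \<in> verts G" "v \<notin> {a, b, c, d, e}" using V by auto
    have t: "\<not> ((v, x) \<in> edges G \<and> (v, y) \<in> edges G)" if "(x, y) \<in> edges G" for x y
      using no_triangle[of v x y] that by blast
    have q: "\<not> ((v, x) \<in> edges G \<and> (v, z) \<in> edges G)"
      if "(x, y) \<in> edges G" "(y, z) \<in> edges G" "v \<noteq> y" "x \<noteq> z" for x y z
      using no_square[of v x y z] that edge_commute by blast
    have "v \<noteq> a" "v \<noteq> b" "v \<noteq> c" "v \<noteq> d" "v \<noteq> e" "a \<noteq> c" "b \<noteq> d" "c \<noteq> e" "d \<noteq> a" "e \<noteq> b"
      using v(2) dist by auto
    note this[simp]
    have "\<not> ((v, a) \<in> edges G \<and> (v, c) \<in> edges G)" "\<not> ((v, b) \<in> edges G \<and> (v, d) \<in> edges G)"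
      "\<not> ((v, c) \<in> edges G \<and> (v, e) \<in> edges G)" "\<not> ((v, d) \<in> edges G \<and> (v, a) \<in> edges G)"
      "\<not> ((v, e) \<in> edges G \<and> (v, b) \<in> edges G)"
      by (rule q[OF e(1,2)] q[OF e(2,3)] q[OF e(3,4)] q[OF e(4,5)] q[OF e(5,1)]; simp)+
    moreover note t[OF e(1)] t[OF e(2)] t[OF e(3)] t[OF e(4)] t[OF e(5)]
    \<comment> \<open>The five rotations of the pentagon, according to which vertex may be the
      neighbour of \<open>v\<close>.\<close>
    moreover have False if "(v, b) \<notin> edges G" "(v, c) \<notin> edges G" "(v, d) \<notin> edges G" "(v, e) \<notin> edges G"
      using pentagon_plus_vertex[OF True e v that] .
    moreover have False if "(v, c) \<notin> edges G" "(v, d) \<notin> edges G" "(v, e) \<notin> edges G" "(v, a) \<notin> edges G"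
      by (rule pentagon_plus_vertex[OF True e(2,3,4,5,1) v(1) _ that]) (use v(2) in auto)
    moreover have False if "(v, d) \<notin> edges G" "(v, e) \<notin> edges G" "(v, a) \<notin> edges G" "(v, b) \<notin> edges G"
      by (rule pentagon_plus_vertex[OF True e(3,4,5,1,2) v(1) _ that]) (use v(2) in auto)
    moreover have False if "(v, e) \<notin> edges G" "(v, a) \<notin> edges G" "(v, b) \<notin> edges G" "(v, c) \<notin> edges G"
      by (rule pentagon_plus_vertex[OF True e(4,5,1,2,3) v(1) _ that]) (use v(2) in auto)
    moreover have False if "(v, a) \<notin> edges G" "(v, b) \<notin> edges G" "(v, c) \<notin> edges G" "(v, d) \<notin> edges G"
      by (rule pentagon_plus_vertex[OF True e(5,1,2,3,4) v(1) _ that]) (use v(2) in auto)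
    ultimately have False by blast
    then show ?thesis by simp
  qed
qed

context
  assumes pf: "pentagon_free G"
begin

lemma no_pentagon: "(a, b) \<in> edges G \<Longrightarrow> (b, c) \<in> edges G \<Longrightarrow> (c, d) \<in> edges G \<Longrightarrow> (d, e) \<in> edges G \<Longrightarrow>
    (e, a) \<notin> edges G"
  using pf unfolding pentagon_free_def by blast

text \<open>With \<open>c\<close> as label 1, legs \<open>a\<close>-\<open>x\<close> and
  \<open>b\<close>-\<open>y\<close> and leaf \<open>d\<close>, every extra edge closes a cycle of
  length 3, 4 or 5. An edge \<open>x\<close>-\<open>y\<close> closes the pentagon \<open>c\<close>,
  \<open>a\<close>, \<open>x\<close>, \<open>y\<close>, \<open>b\<close>, which is why pentagons are
  treated before degree three.\<close>

lemma spider_case: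
  assumes e: "(c, a) \<in> edges G" "(c, b) \<in> edges G" "(c, d) \<in> edges G"
    and dist: "a \<noteq> b" "a \<noteq> d" "b \<noteq> d"
    and x: "(a, x) \<in> edges G" "x \<noteq> c" and y: "(b, y) \<in> edges G" "y \<noteq> c"
  shows "in_O (n - 1) G"
proof -
  let ?vs = "[a, c, b, y, d, x]"
  have s: "(a, c) \<in> edges G" "(b, c) \<in> edges G" "(d, c) \<in> edges G" "(x, a) \<in> edges G" "(y, b) \<in> edges G"
    using e x y edge_commute by blast+
  have ne: "(a, b) \<notin> edges G" "(a, d) \<notin> edges G" "(b, d) \<notin> edges G" "(c, x) \<notin> edges G" "(c, y) \<notin> edges G"
    using no_triangle e s x y by blast+
  have ne1: "(x, b) \<notin> edges G" "(x, d) \<notin> edges G" "(y, a) \<notin> edges G" "(y, d) \<notin> edges G"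
    using no_square[of c a x b] no_square[of c a x d] no_square[of c b y a] no_square[of c b y d] e s x y dist by blast+
  have ne2: "(x, y) \<notin> edges G" using no_pentagon[of c a x y b] e s x y by blast
  have ne': "(b, a) \<notin> edges G" "(d, a) \<notin> edges G" "(d, b) \<notin> edges G" "(x, c) \<notin> edges G" "(y, c) \<notin> edges G"
    "(b, x) \<notin> edges G" "(d, x) \<notin> edges G" "(a, y) \<notin> edges G" "(d, y) \<notin> edges G" "(y, x) \<notin> edges G"
    using ne ne1 ne2 edge_commute by blast+
  have distinct: "distinct ?vs" using e s x y ne ne1 ne2 ne' dist no_loop by auto
  have V: "set ?vs \<subseteq> verts G" using e x y edge_verts by auto
  have "isomorphic G graphE"
  proof (rule min_obstruction_list[OF obs wf V distinct _ _ graphE_not_colourable])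
    show "\<forall>i<length ?vs. \<forall>j<length ?vs. ((?vs ! i, ?vs ! j) \<in> edges G) = ((i, j) \<in> edges graphE)"
      using e s x y ne ne1 ne2 ne' no_loop by (simp add: All_less_Suc graphE_def)
  qed (simp add: graphE_def numeral_eq_Suc)
  moreover have "n \<ge> 8"
    using graphE_bound isomorphic_min_obstruction[OF isomorphic_sym[OF calculation] obs] n by simp
  ultimately show ?thesis unfolding in_O_def by auto
qed

text \<open>Two neighbours of \<open>c\<close> without any other neighbour would be twins, so at
  least two of the three have one and serve as legs.\<close>

lemma degree_three_case:
  assumes "\<not> max_degree_two G"
  shows "in_O (n - 1) G"
proof -
  obtain c a b d where e: "(c, a) \<in> edges G" "(c, b) \<in> edges G" "(c, d) \<in> edges G"
    and dist: "a \<noteq> b" "a \<noteq> d" "b \<noteq> d"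
    using assms unfolding max_degree_two_def by blast
  define ext where "ext u \<longleftrightarrow> (\<exists>z. (u, z) \<in> edges G \<and> z \<noteq> c)" for u
  have pair: "ext u \<or> ext w" if "(c, u) \<in> edges G" "(c, w) \<in> edges G" "u \<noteq> w" for u w
  proof -
    have "u \<in> verts G" "w \<in> verts G" "(u, c) \<in> edges G" "(w, c) \<in> edges G"
      using that edge_verts edge_commute by blast+
    then show ?thesis using separated[of u w] that(3) unfolding ext_def by metis
  qed
  have use2: "in_O (n - 1) G" if "(c, u) \<in> edges G" "(c, w) \<in> edges G" "(c, t) \<in> edges G"
    "u \<noteq> w" "u \<noteq> t" "w \<noteq> t" "ext u" "ext w" for u w t
    using spider_case[OF that(1-6)] that(7,8) unfolding ext_def by blast
  show ?thesis
    using pair[OF e(1,2) dist(1)] pair[OF e(1,3) dist(2)] pair[OF e(2,3) dist(3)]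
      use2[of a b d] use2[of a d b] use2[of b d a] e dist by metis
qed

text \<open>If the length differs from n, the cycle is not colourable, so it is G. If it equals n, G
  has a vertex outside this component, and an exchange gives a contradiction.\<close>

lemma long_cycle_case:
  assumes deg: "max_degree_two G" and p: "cycle_in G p"
  shows "in_C (n - 2) G"
proof -
  let ?m = "length p"
  have pp: "path_in G p" and m3: "?m \<ge> 3" and cl: "(last p, hd p) \<in> edges G"
    using p by (auto simp: cycle_in_def)
  have up: "(p ! j, p ! Suc j) \<in> edges G" if "Suc j < ?m" for j
    using pp that by (simp add: path_in_def)
  have iso: "isomorphic (induced G (set p)) (cycle ?m)"
    and comp: "\<And>x y. x \<in> set p \<Longrightarrow> (x, y) \<in> edges G \<Longrightarrow> y \<in> set p"
    and adj: "\<And>i j. i < ?m \<Longrightarrow> j < ?m \<Longrightarrow> (p ! i, p ! j) \<in> edges G \<longleftrightarrow> (i, j) \<in> edges (cycle ?m)"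
    using max_degree_two_cycle[OF wf deg p] by blast+
  have pV: "set p \<subseteq> verts G" using pp by (simp add: path_in_def)
  have m4: "?m \<noteq> 4"
  proof
    assume 4: "?m = 4"
    have "p ! 0 = p ! 2 \<or> p ! 1 = p ! 3"
    proof (rule no_square)
      have "last p = p ! 3" "hd p = p ! 0" using 4 pp by (auto simp: path_in_def last_conv_nth hd_conv_nth)
      then show "(p ! 3, p ! 0) \<in> edges G" using cl by simp
    qed (use up[of 0] up[of 1] up[of 2] 4 in \<open>simp_all add: numeral_eq_Suc\<close>)
    then show False using 4 path_in_nth_eq[OF pp] by simp
  qed
  have tfc: "twin_free (cycle ?m)" using twin_free_cycle m3 m4 by blast
  show ?thesis
  proof (cases "?m = n")
    case False
    then have isoG: "isomorphic G (cycle ?m)"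
      using min_obstruction_isoI[OF obs wf pV iso] cycle_not_colourable[OF m3 m4] by blast
    have "?m \<le> n"
    proof (rule ccontr)
      assume mn: "\<not> ?m \<le> n"
      have o: "min_obstruction (cycle ?m) (cycle n)"
        using isomorphic_min_obstruction[OF isomorphic_sym[OF isoG] obs] .
      \<comment> \<open>Deleting vertex 0 leaves a path on \<open>?m - 1\<close> vertices; its width
        \<open>?m\<close> must not exceed \<open>n\<close>.\<close>
      let ?S = "{1..<?m}"
      have "twin_free (induced (cycle ?m) ?S)"
        unfolding twin_free_def
      proof (intro ballI impI)
        fix x y assume xy: "x \<in> verts (induced (cycle ?m) ?S)" "y \<in> verts (induced (cycle ?m) ?S)"
          and tw: "\<forall>z\<in>verts (induced (cycle ?m) ?S). ((x, z) \<in> edges (induced (cycle ?m) ?S)) =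
             ((y, z) \<in> edges (induced (cycle ?m) ?S))"
        show "x = y"
          by (rule punctured_cycle_twin_free[of ?m]) (use xy tw mn n in auto)
      qed
      then have "4 * card ?S \<le> card (edges (cycle ?m) \<inter> ?S \<times> ?S) + 2 * n"
        by (intro min_obstruction_card_bound[OF o wf_graph_cycle])
          (use n m3 in \<open>auto simp: psubset_eq dest: equalityD2\<close>)
      moreover have "card (edges (cycle ?m) \<inter> ?S \<times> ?S) \<le>
          card ((\<lambda>i. (i, Suc i)) ` {1..<?m - 1} \<union> (\<lambda>i. (Suc i, i)) ` {1..<?m - 1})"
        by (rule card_mono) (auto simp: edges_cycle image_iff)
      moreover have "\<dots> \<le> card ((\<lambda>i. (i, Suc i)) ` {1..<?m - 1}) + card ((\<lambda>i. (Suc i, i)) ` {1..<?m - 1})"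
        by (rule card_Un_le)
      moreover have "\<dots> \<le> card {1..<?m - 1} + card {1..<?m - 1}"
        by (intro add_mono card_image_le) auto
      ultimately have "4 * card ?S \<le> card {1..<?m - 1} + card {1..<?m - 1} + 2 * n" by linarith
      then show False using mn m3 by simp
    qed
    then have "?m = 3 \<or> 5 \<le> ?m \<and> ?m \<le> n - 2 + 1" using False m3 m4 by auto
    then show ?thesis using isoG unfolding in_C_def by blast
  next
    case True
    have "verts G \<noteq> set p"
    proof
      assume "verts G = set p"
      then have "isomorphic G (cycle n)" using iso induced_verts[OF wf] True by metis
      then have "full_colourable G (cycle n)" unfolding isomorphic_full_hom full_colourable_def by blast
      then show False using obs unfolding min_obstruction_def by blast
    qed
    then obtain v where v: "v \<in> verts G" "v \<notin> set p" using pV by blast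
    have vn: "(v, x) \<notin> edges G \<and> (x, v) \<notin> edges G" if "x \<in> set p" for x
      using comp[OF that, of v] v(2) edge_commute by blast
    \<comment> \<open>The exchange keeps n vertices but makes \<open>v\<close> isolated, against the
      two neighbours that an onto embedding forces.\<close>
    let ?S = "insert v (set p - {p ! 0})"
    have p0: "p ! 0 \<in> set p" by (rule nth_mem) (use m3 in linarith)
    then have "?S \<subset> verts G" using v pV by auto
    then have col: "full_colourable (induced G ?S) (cycle n)"
      using obs unfolding min_obstruction_def by blast
    have "card (set p) = n" using pp True distinct_card by (auto simp: path_in_def)
    then have "card ?S = n" using v(2) p0 n by simp
    moreover have "twin_free (induced G ?S)"
      unfolding twin_free_def
    proof (intro ballI impI)
      fix x y assume xy: "x \<in> verts (induced G ?S)" "y \<in> verts (induced G ?S)"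
        and tw: "\<forall>z\<in>verts (induced G ?S). ((x, z) \<in> edges (induced G ?S)) = ((y, z) \<in> edges (induced G ?S))"
      have inS: "p ! i \<in> ?S" if "1 \<le> i" "i < ?m" for i
        using that path_in_nth_eq[OF pp, of i 0] m3 by fastforce
      have idx: "x = v \<or> (\<exists>i. 1 \<le> i \<and> i < ?m \<and> x = p ! i)" if "x \<in> ?S" for x
        using that by (auto simp: in_set_conv_nth) (metis One_nat_def Suc_leI gr0I)
      have nbr: "\<exists>z\<in>?S. (p ! i, z) \<in> edges G" if i: "1 \<le> i" "i < ?m" for i
      proof (cases "Suc i < ?m")
        case True
        then show ?thesis using up[OF True] inS[of "Suc i"] by auto
      next
        case False
        then have "(p ! i, p ! (i - 1)) \<in> edges G" "p ! (i - 1) \<in> ?S"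
          using up[of "i - 1"] edge_commute inS[of "i - 1"] i \<open>?m = n\<close> n by auto
        then show ?thesis by blast
      qed
      have tw': "(x, z) \<in> edges G \<longleftrightarrow> (y, z) \<in> edges G" if "z \<in> ?S" for z
        using tw xy that unfolding verts_induced edges_induced by blast
      have vS: "(v, z) \<notin> edges G" if "z \<in> ?S" for z using that vn no_loop by blast
      show "x = y"
      proof (cases "x = v \<or> y = v")
        case True
        then show ?thesis using idx[of x] idx[of y] xy nbr tw' vS by (metis verts_induced)
      next
        case False
        then obtain i j where ij: "1 \<le> i" "i < ?m" "x = p ! i" "1 \<le> j" "j < ?m" "y = p ! j"
          using idx xy by (metis verts_induced)
        have "i = j"
        proof (rule punctured_cycle_twin_free)
          show "(i, z) \<in> edges (cycle ?m) \<longleftrightarrow> (j, z) \<in> edges (cycle ?m)" if "1 \<le> z" "z < ?m" for z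
            using tw'[OF inS[OF that]] ij adj that by simp
        qed (use ij n \<open>?m = n\<close> in auto)
        then show ?thesis using ij by simp
      qed
    qed
    ultimately obtain x where "x \<in> ?S" "(v, x) \<in> edges G"
      using spanning_embedding_two_nbrs[OF col, of v] n by auto
    then show ?thesis using vn no_loop by blast
  qed
qed

end
end
end

text \<open>The order of the cases matters: each reads its non-edges off the cycles excluded before
  it.\<close>

lemma obstruction_classification: "in_C (n - 2) G \<or> in_LF (n - 1) G \<or> in_O (n - 1) G"
proof (cases "triangle_free G \<and> square_free G \<and> pentagon_free G \<and> max_degree_two G \<and> (\<forall>p. \<not> cycle_in G p)")
  case True
  then obtain ls where ls: "0 \<notin> set ls" "isomorphic G (path_forest ls)"
    using linear_forest_iso[OF wf] by blast
  have "min_obstruction (path_forest ls) (cycle n)"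
    using isomorphic_min_obstruction[OF isomorphic_sym[OF ls(2)] obs] .
  then have "in_LF (n - 1) (path_forest ls)" using obs_path_forest_in_LF[OF n _ ls(1)] by blast
  then show ?thesis using isomorphic_trans[OF ls(2)] unfolding in_LF_def by blast
next
  case False
  then consider "\<not> triangle_free G" | "triangle_free G" "\<not> square_free G"
    | "triangle_free G" "square_free G" "\<not> pentagon_free G"
    | "triangle_free G" "square_free G" "pentagon_free G" "\<not> max_degree_two G"
    | p where "triangle_free G" "square_free G" "pentagon_free G" "max_degree_two G" "cycle_in G p"
    by blast
  then show ?thesis
  proof cases
    case 1
    then show ?thesis using triangle_case unfolding triangle_free_def by blast
  next
    case 2
    then show ?thesis using square_case[OF 2(1)] unfolding square_free_def by blast
  next
    case 3
    then show ?thesis using pentagon_case[OF 3(1,2)] unfolding pentagon_free_def by blast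
  next
    case 4
    then show ?thesis using degree_three_case by blast
  next
    case 5
    then show ?thesis using long_cycle_case by blast
  qed
qed

end

section \<open>The listed graphs are obstructions\<close>

lemma in_C_min_obstruction:
  assumes "n \<ge> 5" "in_C (n - 2) G"
  shows "min_obstruction G (cycle n)"
proof -
  obtain m where m: "m = 3 \<or> 5 \<le> m \<and> m \<le> n - 2 + 1" "isomorphic G (cycle m)"
    using assms(2) unfolding in_C_def by blast
  have "min_obstruction (cycle m) (cycle n)"
    by (rule cycle_min_obstruction) (use m(1) assms(1) in auto)
  then show ?thesis using isomorphic_min_obstruction[OF m(2)] by blast
qed

lemma in_O_min_obstruction:
  assumes "in_O (n - 1) G"
  shows "min_obstruction G (cycle n)"
proof -
  \<comment> \<open>Since \<open>k = n - 1\<close>, the values 5, 6, 7 of \<open>k\<close> in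
    \<open>in_O\<close> become 6, 7, 8 for \<open>n\<close>.\<close>
  consider "isomorphic G graphA" "n \<ge> 7" | "isomorphic G graphB" "n \<ge> 6" | "isomorphic G graphE" "n \<ge> 8"
    using assms unfolding in_O_def by fastforce
  then show ?thesis
  proof cases
    case 1
    then show ?thesis using isomorphic_min_obstruction graphA_min_obstruction by metis
  next
    case 2
    then show ?thesis using isomorphic_min_obstruction graphB_min_obstruction by metis
  next
    case 3
    then show ?thesis using isomorphic_min_obstruction graphE_min_obstruction by metis
  qed
qed

theorem theorem3p10:
  fixes G :: "'a graph" and n :: nat
  assumes "n \<ge> 5" and "wf_graph G"
  shows "min_obstruction G (cycle n) \<longleftrightarrow>
           (in_C (n - 2) G \<or> in_LF (n - 1) G \<or> in_O (n - 1) G)"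
  using obstruction_classification[OF assms] in_C_min_obstruction[OF assms(1)]
    in_LF_min_obstruction[OF assms(1)] in_O_min_obstruction by blast

end
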